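(* Let $(\mathcal{X},\mathcal{T})$ be a non-degenerate Banach $L^1(\mathbb{R})$-module with structure associated with an isometric representation $\mathcal{T}$ that is strongly continuous. Assume that a function $h\in\mathcal{F}L^1_{loc}(\mathbb{R})$ is spectrally admissible. Then $\sigma(\check{\mathcal{T}}(h))=\overline{h(\Lambda(\mathcal{X},\mathcal{T}))}$. Moreover, given $\lambda\notin\overline{h(\Lambda(\mathcal{X},\mathcal{T}))}$, we have $$\left\|(\lambda I-\check{\mathcal{T}}(h))^{-1}\right\|\le M_h(\lambda).$$
   Context: $\mathcal{X}$ is a complex Banach space, $B(\mathcal{X})$ is the algebra of bounded linear operators on $\mathcal{X}$. A Banach $L^1(\mathbb{R})$-module structure on $\mathcal{X}$ is a bilinear map $(f,x)\mapsto fx: L^1(\mathbb{R})\times\mathcal{X}\to\mathcal{X}$ with $(f*g)x=f(gx)$ (convolution) and $\|fx\|\le\|f\|_1\|x\|$. It is non-degenerate if $fx=0$ for all $f\in L^1(\mathbb{R})$ implies $x=0$. It is associated with an isometric representation (group homomorphism into isometries) $\mathcal{T}:\mathbb{R}\to B(\mathcal{X})$ if $\mathcal{T}(t)(fx)=f_tx=f(\mathcal{T}(t)x)$ for $t\in\mathbb{R}$, $f\in L^1(\mathbb{R})$, $x\in\mathcal{X}$, where $f_t(s)=f(t+s)$. For $f\in L^1(\mathbb{R})$ write $\mathcal{T}(f)\in B(\mathcal{X})$, $\mathcal{T}(f)x=fx$. Fourier transform: $\widehat f(\xi)=\int_{\mathbb{R}}f(t)e^{-it\xi}dt$; $\mathcal{F}L^1=\{\widehat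 f: f\in L^1(\mathbb{R})\}$, and $\mathcal{F}^{-1}(h)=\check h=h^\vee$ is the inverse Fourier transform of $h\in\mathcal{F}L^1$. Beurling spectrum: for $N\subseteq\mathcal{X}$, $\Lambda(N)=\Lambda(N,\mathcal{T})$ is the set of $\lambda\in\mathbb{R}$ such that for every $f\in L^1(\mathbb{R})$, if $fx=0$ for all $x\in N$ then $\widehat f(\lambda)=0$; $\Lambda(x)=\Lambda(\{x\})$. $\mathcal{X}_{comp}=\{x\in\mathcal{X}:\Lambda(x)\text{ is compact}\}$. $\mathcal{F}L^1_{loc}(\mathbb{R})$ is the set of $h:\mathbb{R}\to\mathbb{C}$ such that $h\widehat\varphi\in\mathcal{F}L^1$ for every $\varphi\in L^1(\mathbb{R})$ with $\operatorname{supp}\widehat\varphi$ compact. For $h\in\mathcal{F}L^1_{loc}(\mathbb{R})$ the closed operator $\check{\mathcal{T}}(h):D(\check{\mathcal{T}}(h))\subseteq\mathcal{X}\to\mathcal{X}$ is defined as follows: for $x\in\mathcal{X}_{comp}$, $\check{\mathcal{T}}(h)x=\mathcal{T}((h\widehat\varphi)^\vee)x$, where $\varphi\in L^1(\mathbb{R})$ is any function with $\operatorname{supp}\widehat\varphi$ compact and $\widehat\varphi\equiv1$ in a neighborhood of $\Lambda(x)$ (the result is independent of $\varphi$); then $\check{\mathcal{T}}(h)$ is the closure of this operator on $\mathcal{X}_{comp}$. For $a>0$ let $\varphi_a\in L^1(\mathbb{R})$ be the function with $\widehat\varphi_a=\tau_a$, where $\tau_a(\xi)=1$ for $|\xi|\le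 a$, $\tau_a(\xi)=\frac1a(2a-|\xi|)$ for $a<|\xi|<2a$, and $\tau_a(\xi)=0$ for $|\xi|\ge 2a$. A function $h\in\mathcal{F}L^1_{loc}(\mathbb{R})$ is called spectrally admissible if for each $\lambda\in\mathbb{C}\setminus\overline{h(\Lambda(\mathcal{X},\mathcal{T}))}$ there exist functions $g^a_\lambda\in\mathcal{F}L^1$, $a>0$, such that $g^a_\lambda=\frac{\widehat\varphi_a}{\lambda-h}$ in a neighborhood of $\Lambda(\mathcal{X},\mathcal{T})$ and $$M_h(\lambda):=\sup_{a>0}\left\|\mathcal{F}^{-1}(g^a_\lambda)\right\|_1<\infty.$$ *)

theory Defs
  imports "HOL-Analysis.Analysis"
begin

section \<open>Complex Banach spaces\<close>

text \<open>The real scalar multiplication and norm of class \<open>banach\<close> are those induced by the complex structure.\<close>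

class complex_banach = banach +
  fixes scaleC :: "complex \<Rightarrow> 'a \<Rightarrow> 'a"  (infixr \<open>*\<^sub>C\<close> 75)
  assumes scaleC_add_right: "c *\<^sub>C (x + y) = c *\<^sub>C x + c *\<^sub>C y"
    and scaleC_add_left: "(c + d) *\<^sub>C x = c *\<^sub>C x + d *\<^sub>C x"
    and scaleC_scaleC: "c *\<^sub>C (d *\<^sub>C x) = (c * d) *\<^sub>C x"
    and scaleC_of_real: "complex_of_real r *\<^sub>C x = r *\<^sub>R x"
    and norm_scaleC: "norm (c *\<^sub>C x) = cmod c * norm x"

definition bounded_clinear :: "('x::complex_banach \<Rightarrow> 'x) \<Rightarrow> bool" where
  "bounded_clinear A \<longleftrightarrow> bounded_linear A \<and> (\<forall>c x. A (c *\<^sub>C x) = c *\<^sub>C A x)"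

section \<open>The convolution algebra of integrable functions and the Fourier transform\<close>

text \<open>Elements of \<open>L\<^sup>1\<close> are represented by integrable functions, not by classes modulo null sets.\<close>

definition L1 :: "(real \<Rightarrow> complex) set" where
  "L1 = {f. integrable lborel f}"

definition L1_norm :: "(real \<Rightarrow> complex) \<Rightarrow> real" where
  "L1_norm f = (LINT t|lborel. cmod (f t))"

definition convolution :: "(real \<Rightarrow> complex) \<Rightarrow> (real \<Rightarrow> complex) \<Rightarrow> real \<Rightarrow> complex" where
  "convolution f g = (\<lambda>t. LINT s|lborel. f (t - s) * g s)"

definition fourier :: "(real \<Rightarrow> complex) \<Rightarrow> real \<Rightarrow> complex" where
  "fourier f = (\<lambda>\<xi>. LINT t|lborel. f t * exp (- (\<i> * of_real t * of_real \<xi>)))"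

definition FL1 :: "(real \<Rightarrow> complex) set" where
  "FL1 = fourier ` L1"

text \<open>The preimage under the Fourier transform is unique only up to a null set; neither the norm
  \<open>L1_norm\<close> nor the module action below depends on the chosen representative.\<close>

definition inv_fourier :: "(real \<Rightarrow> complex) \<Rightarrow> real \<Rightarrow> complex" where
  "inv_fourier h = (SOME f. f \<in> L1 \<and> fourier f = h)"

definition supp :: "(real \<Rightarrow> complex) \<Rightarrow> real set" where
  "supp h = closure {\<xi>. h \<xi> \<noteq> 0}"

definition FL1_loc :: "(real \<Rightarrow> complex) set" where
  "FL1_loc = {h. \<forall>\<phi>\<in>L1. compact (supp (fourier \<phi>)) \<longrightarrow> (\<lambda>\<xi>. h \<xi> * fourier \<phi> \<xi>) \<in> FL1}"

section \<open>Banach modules over the convolution algebra\<close>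

text \<open>The action is a function on all of \<open>real \<Rightarrow> complex\<close>; only its values at integrable functions matter.
  Additivity and the norm bound make it respect equality almost everywhere.\<close>

definition banach_L1_module :: "((real \<Rightarrow> complex) \<Rightarrow> 'x::complex_banach \<Rightarrow> 'x) \<Rightarrow> bool" where
  "banach_L1_module act \<longleftrightarrow>
     (\<forall>f\<in>L1. \<forall>g\<in>L1. \<forall>x. act (\<lambda>t. f t + g t) x = act f x + act g x) \<and>
     (\<forall>c. \<forall>f\<in>L1. \<forall>x. act (\<lambda>t. c * f t) x = c *\<^sub>C act f x) \<and>
     (\<forall>f\<in>L1. \<forall>x y. act f (x + y) = act f x + act f y) \<and>
     (\<forall>f\<in>L1. \<forall>c x. act f (c *\<^sub>C x) = c *\<^sub>C act f x) \<and>
     (\<forall>f\<in>L1. \<forall>g\<in>L1. \<forall>x. act (convolution f g) x = act f (act g x)) \<and>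
     (\<forall>f\<in>L1. \<forall>x. norm (act f x) \<le> L1_norm f * norm x)"

definition nondegenerate :: "((real \<Rightarrow> complex) \<Rightarrow> 'x::complex_banach \<Rightarrow> 'x) \<Rightarrow> bool" where
  "nondegenerate act \<longleftrightarrow> (\<forall>x. (\<forall>f\<in>L1. act f x = 0) \<longrightarrow> x = 0)"

definition isometric_representation :: "(real \<Rightarrow> 'x::complex_banach \<Rightarrow> 'x) \<Rightarrow> bool" where
  "isometric_representation T \<longleftrightarrow>
     (\<forall>t. bounded_clinear (T t)) \<and> (\<forall>t x. norm (T t x) = norm x) \<and>
     T 0 = id \<and> (\<forall>s t. T (s + t) = T s \<circ> T t)"

definition strongly_continuous :: "(real \<Rightarrow> 'x::complex_banach \<Rightarrow> 'x) \<Rightarrow> bool" where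
  "strongly_continuous T \<longleftrightarrow> (\<forall>x. continuous_on UNIV (\<lambda>t. T t x))"

definition associated ::
  "((real \<Rightarrow> complex) \<Rightarrow> 'x::complex_banach \<Rightarrow> 'x) \<Rightarrow> (real \<Rightarrow> 'x \<Rightarrow> 'x) \<Rightarrow> bool" where
  "associated act T \<longleftrightarrow>
     (\<forall>t. \<forall>f\<in>L1. \<forall>x. T t (act f x) = act (\<lambda>s. f (t + s)) x \<and>
                         act (\<lambda>s. f (t + s)) x = act f (T t x))"

definition beurling_spectrum ::
  "((real \<Rightarrow> complex) \<Rightarrow> 'x::complex_banach \<Rightarrow> 'x) \<Rightarrow> 'x set \<Rightarrow> real set" where
  "beurling_spectrum act N =
     {\<xi>. \<forall>f\<in>L1. (\<forall>x\<in>N. act f x = 0) \<longrightarrow> fourier f \<xi> = 0}"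

definition X_comp :: "((real \<Rightarrow> complex) \<Rightarrow> 'x::complex_banach \<Rightarrow> 'x) \<Rightarrow> 'x set" where
  "X_comp act = {x. compact (beurling_spectrum act {x})}"

section \<open>Unbounded operators and their spectra\<close>

text \<open>An operator is given by its graph \<open>G\<close>: its domain is \<open>Domain G\<close>, and \<open>op_apply G x\<close> is its value at
  \<open>x \<in> Domain G\<close>.\<close>

definition op_apply :: "('x \<times> 'x) set \<Rightarrow> 'x \<Rightarrow> 'x" where
  "op_apply G x = (THE y. (x, y) \<in> G)"

definition resolvent :: "('x::complex_banach \<times> 'x) set \<Rightarrow> complex \<Rightarrow> 'x \<Rightarrow> 'x" where
  "resolvent G \<mu> = inv_into (Domain G) (\<lambda>x. \<mu> *\<^sub>C x - op_apply G x)"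

definition resolvent_set :: "('x::complex_banach \<times> 'x) set \<Rightarrow> complex set" where
  "resolvent_set G =
     {\<mu>. bij_betw (\<lambda>x. \<mu> *\<^sub>C x - op_apply G x) (Domain G) UNIV \<and> bounded_clinear (resolvent G \<mu>)}"

definition spectrum :: "('x::complex_banach \<times> 'x) set \<Rightarrow> complex set" where
  "spectrum G = - resolvent_set G"

text \<open>The graph of the closed operator defined by \<open>h\<close>: the closure in \<open>\<X> \<times> \<X>\<close> of the graph of
  the operator defined on \<open>X_comp act\<close>. All admissible cut-off functions \<open>\<phi>\<close> are collected, as the
  value does not depend on the choice.\<close>

definition T_check_comp_graph ::
  "((real \<Rightarrow> complex) \<Rightarrow> 'x::complex_banach \<Rightarrow> 'x) \<Rightarrow> (real \<Rightarrow> complex) \<Rightarrow> ('x \<times> 'x) set" where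
  "T_check_comp_graph act h =
     {(x, act (inv_fourier (\<lambda>\<xi>. h \<xi> * fourier \<phi> \<xi>)) x) | x \<phi>.
        x \<in> X_comp act \<and> \<phi> \<in> L1 \<and> compact (supp (fourier \<phi>)) \<and>
        (\<exists>U. open U \<and> beurling_spectrum act {x} \<subseteq> U \<and> (\<forall>\<xi>\<in>U. fourier \<phi> \<xi> = 1))}"

definition T_check ::
  "((real \<Rightarrow> complex) \<Rightarrow> 'x::complex_banach \<Rightarrow> 'x) \<Rightarrow> (real \<Rightarrow> complex) \<Rightarrow> ('x \<times> 'x) set" where
  "T_check act h = closure (T_check_comp_graph act h)"

section \<open>Spectral admissibility\<close>

definition tau :: "real \<Rightarrow> real \<Rightarrow> real" where
  "tau a \<xi> = (if \<bar>\<xi>\<bar> \<le> a then 1 else if \<bar>\<xi>\<bar> < 2 * a then (2 * a - \<bar>\<xi>\<bar>) / a else 0)"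

text \<open>\<open>g a\<close> plays the role of \<open>g\<^sub>\<mu>\<^sup>a\<close>, and \<open>tau a\<close> is the Fourier transform of \<open>\<phi>\<^sub>a\<close>.
  The condition \<open>h \<xi> \<noteq> \<mu>\<close> makes the quotient meaningful on the neighbourhood \<open>U\<close>, which may depend on \<open>a\<close>.\<close>

definition admissible_family ::
  "((real \<Rightarrow> complex) \<Rightarrow> 'x::complex_banach \<Rightarrow> 'x) \<Rightarrow> (real \<Rightarrow> complex) \<Rightarrow> complex \<Rightarrow>
   (real \<Rightarrow> real \<Rightarrow> complex) \<Rightarrow> bool" where
  "admissible_family act h \<mu> g \<longleftrightarrow>
     (\<forall>a>0. g a \<in> FL1 \<and>
        (\<exists>U. open U \<and> beurling_spectrum act UNIV \<subseteq> U \<and>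
             (\<forall>\<xi>\<in>U. h \<xi> \<noteq> \<mu> \<and> g a \<xi> = of_real (tau a \<xi>) / (\<mu> - h \<xi>)))) \<and>
     bdd_above ((\<lambda>a. L1_norm (inv_fourier (g a))) ` {0<..})"

definition M_bound :: "(real \<Rightarrow> real \<Rightarrow> complex) \<Rightarrow> real" where
  "M_bound g = (SUP a\<in>{0<..}. L1_norm (inv_fourier (g a)))"

definition spectrally_admissible ::
  "((real \<Rightarrow> complex) \<Rightarrow> 'x::complex_banach \<Rightarrow> 'x) \<Rightarrow> (real \<Rightarrow> complex) \<Rightarrow> bool" where
  "spectrally_admissible act h \<longleftrightarrow> h \<in> FL1_loc \<and>
     (\<forall>\<mu>. \<mu> \<notin> closure (h ` beurling_spectrum act UNIV) \<longrightarrow> (\<exists>g. admissible_family act h \<mu> g))"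

end

theory Submission
  imports "HOL-Probability.Characteristic_Functions" "HOL-Probability.Sinc_Integral" Defs
begin

text \<open>For a Fourier transform \<open>m\<close> of an integrable function let \<open>m(\<T>)\<close> (here \<open>multiplier m\<close>) be the bounded
operator by which that function acts. The map from \<open>m\<close> to \<open>m(\<T>)\<close> is a homomorphism for pointwise
multiplication, and the theorem is what this functional calculus gives once two facts are known.

First, \<open>m(\<T>) y\<close> depends only on \<open>m\<close> near the Beurling spectrum of \<open>y\<close>
(\<open>multiplier_vanish\<close>, \<open>multiplier_cong\<close>). This is the Wiener-type part. Near a point \<open>c\<close> outside the
spectrum some \<open>G(\<T>)\<close> annihilates \<open>y\<close> although \<open>G c \<noteq> 0\<close>; on a small enough neighbourhood of \<open>c\<close> the operator
of \<open>G\<close> differs little from the scalar \<open>G c\<close> (\<open>multiplier_local_approx\<close>), so nothing in \<open>y\<close> lives there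
(\<open>multiplier_vanish_near_point\<close>). A partition of unity into tent functions globalises this.

Secondly, band-limited multipliers approximate the identity strongly (\<open>multiplier_cutoff_tendsto\<close>). This is
where non-degeneracy and the strong continuity of the representation enter, through
\<open>act_pulse_tendsto\<close>.

With both, the closed operator of \<open>h\<close> is identified without any closure (\<open>T_check_eq\<close>): \<open>(x, y)\<close> is in
its graph iff \<open>m(\<T>) y = (h m)(\<T>) x\<close> for all band-limited \<open>m\<close>. Outside the closure of
\<open>h(\<Lambda>)\<close>, where \<open>\<Lambda>\<close> is the Beurling spectrum of the module, the operators \<open>g\<^sub>a(\<T>)\<close> of an admissible family are
uniformly bounded by \<open>M_bound g\<close> and become stationary on band-limited vectors as \<open>a\<close> grows. Hence they
converge strongly; the limit inverts \<open>\<mu> - h(\<T>)\<close> because \<open>g\<^sub>a (\<mu> - h)\<close> is \<open>1\<close> on \<open>[-a, a]\<close> near \<open>\<Lambda>\<close>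
(\<open>resolvent_from_admissible_family\<close>). Conversely, vectors whose spectrum is concentrated near a point
\<open>c \<in> \<Lambda>\<close> are approximate eigenvectors for \<open>h c\<close> (\<open>approximate_eigenvector\<close>), so a point at which the resolvent
exists and is bounded by \<open>K\<close> has distance at least \<open>1 / K\<close> from \<open>h(\<Lambda>)\<close>
(\<open>resolvent_set_disjoint_closure\<close>).\<close>

section \<open>Continuity of translation in the L1 norm\<close>

lemma L1_measurable [measurable_dest]: "f \<in> L1 \<Longrightarrow> f \<in> borel_measurable borel"
  by (auto simp: L1_def dest: borel_measurable_integrable)

lemma L1_add: "f \<in> L1 \<Longrightarrow> g \<in> L1 \<Longrightarrow> (\<lambda>t. f t + g t) \<in> L1"
  by (simp add: L1_def)

lemma L1_diff: "f \<in> L1 \<Longrightarrow> g \<in> L1 \<Longrightarrow> (\<lambda>t. f t - g t) \<in> L1"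
  by (simp add: L1_def)

lemma L1_cmult: "f \<in> L1 \<Longrightarrow> (\<lambda>t. c * f t) \<in> L1"
  by (simp add: L1_def)

lemma L1_affine: "f \<in> L1 \<Longrightarrow> c \<noteq> 0 \<Longrightarrow> (\<lambda>t. f (a + c * t)) \<in> L1"
  by (simp add: L1_def lborel_integrable_real_affine_iff)

lemma L1_translate: "f \<in> L1 \<Longrightarrow> (\<lambda>t. f (t - s)) \<in> L1"
  using L1_affine[of f 1 "- s"] by (simp add: algebra_simps)

lemma L1_norm_nonneg [simp]: "0 \<le> L1_norm f"
  by (simp add: L1_norm_def)

lemma L1_norm_triangle:
  assumes "f \<in> L1" "g \<in> L1"
  shows "L1_norm (\<lambda>t. f t + g t) \<le> L1_norm f + L1_norm g"
proof -
  have "L1_norm (\<lambda>t. f t + g t) \<le> (LINT t|lborel. cmod (f t) + cmod (g t))"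
    unfolding L1_norm_def using assms
    by (intro integral_mono norm_triangle_ineq) (auto simp: L1_def)
  then show ?thesis using assms by (simp add: L1_norm_def L1_def)
qed

lemma L1_norm_cmult: "L1_norm (\<lambda>t. c * f t) = cmod c * L1_norm f"
  by (simp add: L1_norm_def norm_mult)

lemma L1_norm_triangle_diff:
  assumes "f \<in> L1" "g \<in> L1" "h \<in> L1"
  shows "L1_norm (\<lambda>t. f t - h t) \<le> L1_norm (\<lambda>t. f t - g t) + L1_norm (\<lambda>t. g t - h t)"
  using L1_norm_triangle[OF L1_diff[OF assms(1,2)] L1_diff[OF assms(2,3)]] by simp

lemma L1_norm_affine: "c \<noteq> 0 \<Longrightarrow> L1_norm (\<lambda>t. f (a + c * t)) = L1_norm f / \<bar>c\<bar>"
  unfolding L1_norm_def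
  using lborel_integral_real_affine[of c "\<lambda>t. cmod (f t)" a] by simp

lemma L1_norm_translate: "L1_norm (\<lambda>t. f (t - s)) = L1_norm f"
  using L1_norm_affine[of 1 f "- s"] by (simp add: algebra_simps)

lemma L1_norm_minus_commute: "L1_norm (\<lambda>t. f t - g t) = L1_norm (\<lambda>t. g t - f t)"
  by (simp add: L1_norm_def norm_minus_commute)

text \<open>The \<open>L\<^sup>1\<close> modulus of continuity of \<open>f\<close>.\<close>

definition shift_modulus :: "(real \<Rightarrow> complex) \<Rightarrow> real \<Rightarrow> real" where
  "shift_modulus f s = L1_norm (\<lambda>t. f (t - s) - f t)"

lemma shift_modulus_nonneg [simp]: "0 \<le> shift_modulus f s"
  by (simp add: shift_modulus_def)

lemma shift_modulus_le:
  assumes "f \<in> L1" shows "shift_modulus f s \<le> 2 * L1_norm f"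
proof -
  have "shift_modulus f s \<le> L1_norm (\<lambda>t. f (t - s)) + L1_norm (\<lambda>t. (-1) * f t)"
    unfolding shift_modulus_def
    using L1_norm_triangle[OF L1_translate[OF assms] L1_cmult[OF assms], of s "-1"] by simp
  then show ?thesis
    using L1_norm_cmult[of "-1" f] L1_norm_translate[of f s] by simp
qed

lemma shift_modulus_close:
  assumes "f \<in> L1" "g \<in> L1"
  shows "shift_modulus f s \<le> shift_modulus g s + 2 * L1_norm (\<lambda>t. f t - g t)"
proof -
  have "L1_norm (\<lambda>t. f (t - s) - f t) \<le>
      L1_norm (\<lambda>t. f (t - s) - g (t - s)) + L1_norm (\<lambda>t. g (t - s) - f t)"
    by (intro L1_norm_triangle_diff L1_translate assms)
  also have "L1_norm (\<lambda>t. g (t - s) - f t) \<le> L1_norm (\<lambda>t. g (t - s) - g t) + L1_norm (\<lambda>t. g t - f t)"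
    by (intro L1_norm_triangle_diff L1_translate assms)
  also have "L1_norm (\<lambda>t. f (t - s) - g (t - s)) = L1_norm (\<lambda>t. f t - g t)"
    by (rule L1_norm_translate)
  also have "L1_norm (\<lambda>t. g t - f t) = L1_norm (\<lambda>t. f t - g t)"
    by (rule L1_norm_minus_commute)
  finally show ?thesis by (simp add: shift_modulus_def)
qed

text \<open>Functions whose translates vary continuously form a closed set, since translating an error does not
change its norm. This reduces the continuity of translation to indicators of open sets.\<close>

lemma shift_modulus_tendsto_approx:
  assumes f: "f \<in> L1"
    and approx: "\<And>e. e > 0 \<Longrightarrow> \<exists>g\<in>L1. L1_norm (\<lambda>t. f t - g t) < e \<and> (shift_modulus g \<longlongrightarrow> 0) (at 0)"
  shows "(shift_modulus f \<longlongrightarrow> 0) (at 0)"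
proof (rule tendstoI)
  fix e :: real assume e: "e > 0"
  obtain g where g: "g \<in> L1" "L1_norm (\<lambda>t. f t - g t) < e / 4" "(shift_modulus g \<longlongrightarrow> 0) (at 0)"
    using approx[of "e / 4"] e by auto
  have "\<forall>\<^sub>F s in at 0. dist (shift_modulus g s) 0 < e / 2"
    using tendstoD[OF g(3), of "e / 2"] e by simp
  then show "\<forall>\<^sub>F s in at 0. dist (shift_modulus f s) 0 < e"
  proof eventually_elim
    case (elim s)
    then show ?case using shift_modulus_close[OF f g(1), of s] g(2) by simp
  qed
qed

text \<open>For an open set \<open>U\<close> the product of its indicator with a translated copy converges pointwise to the indicator as
the shift tends to \<open>0\<close>: a point of \<open>U\<close> stays in \<open>U\<close> under small shifts, and outside \<open>U\<close> the product is \<open>0\<close>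
anyway. So the measure of the overlap converges, and the symmetric difference is twice what the overlap
lacks.\<close>

lemma shift_modulus_indicator_open:
  fixes U :: "real set" and c :: complex
  assumes U: "open U" and fin: "emeasure lborel U < \<infinity>"
  shows "(shift_modulus (\<lambda>t. indicator U t *\<^sub>R c) \<longlongrightarrow> 0) (at 0)"
proof -
  let ?m = "LINT t|lborel. indicat_real U t"
  define p where "p s = (LINT t|lborel. indicat_real U t * indicat_real U (t - s))" for s
  have [measurable]: "U \<in> sets borel" using U by auto
  have iU: "integrable lborel (indicat_real U)"
    using fin by (simp add: integrable_real_indicator)
  have iUs: "integrable lborel (\<lambda>t. indicat_real U (t - s))" for s
    using lborel_integrable_real_affine_iff[of 1 "indicat_real U" "- s"] iU by (simp add: algebra_simps)
  have mUs: "(LINT t|lborel. indicat_real U (t - s)) = ?m" for s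
    using lborel_integral_real_affine[of 1 "indicat_real U" "- s"] by (simp add: algebra_simps)
  have ip: "integrable lborel (\<lambda>t. indicat_real U t * indicat_real U (t - s))" for s
    by (rule Bochner_Integration.integrable_bound[OF iU]) (auto simp: indicator_def)
  have p: "(p \<longlongrightarrow> ?m) (at 0)"
    unfolding p_def tendsto_at_iff_sequentially o_def
  proof (intro allI impI)
    fix X :: "nat \<Rightarrow> real" assume X: "\<forall>i. X i \<in> UNIV - {0}" "X \<longlonglongrightarrow> 0"
    show "(\<lambda>n. LINT t|lborel. indicat_real U t * indicat_real U (t - X n)) \<longlonglongrightarrow> ?m"
    proof (rule integral_dominated_convergence[where w="indicat_real U"])
      show "AE t in lborel. (\<lambda>i. indicat_real U t * indicat_real U (t - X i)) \<longlonglongrightarrow> indicat_real U t"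
      proof (rule AE_I2)
        fix t
        show "(\<lambda>i. indicat_real U t * indicat_real U (t - X i)) \<longlonglongrightarrow> indicat_real U t"
        proof (cases "t \<in> U")
          case True
          have "(\<lambda>i. t - X i) \<longlonglongrightarrow> t" using tendsto_diff[OF tendsto_const X(2), of t] by simp
          then have "\<forall>\<^sub>F i in sequentially. t - X i \<in> U"
            using U True by (simp add: topological_tendstoD)
          then have "\<forall>\<^sub>F i in sequentially. indicat_real U t * indicat_real U (t - X i) = indicat_real U t"
            by eventually_elim (simp add: True)
          then show ?thesis by (rule tendsto_eventually)
        qed simp
      qed
    qed (use iU in \<open>auto simp: indicator_def\<close>)
  qed
  have "shift_modulus (\<lambda>t. indicator U t *\<^sub>R c) s = cmod c * (2 * (?m - p s))" for s
  proof -
    have "shift_modulus (\<lambda>t. indicator U t *\<^sub>R c) s =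
       (LINT t|lborel. cmod c * (indicat_real U (t - s) + indicat_real U t
          - 2 * (indicat_real U t * indicat_real U (t - s))))"
      unfolding shift_modulus_def L1_norm_def
      by (intro Bochner_Integration.integral_cong) (auto simp: indicator_def)
    also have "\<dots> = cmod c * (?m + ?m - 2 * p s)"
      using iU iUs[of s] ip[of s] by (simp add: mUs p_def)
    finally show ?thesis by simp
  qed
  then have "shift_modulus (\<lambda>t. indicator U t *\<^sub>R c) = (\<lambda>s. cmod c * (2 * (?m - p s)))" by auto
  moreover have "((\<lambda>s. cmod c * (2 * (?m - p s))) \<longlongrightarrow> cmod c * (2 * (?m - ?m))) (at 0)"
    by (intro tendsto_intros p)
  ultimately show ?thesis by simp
qed

text \<open>By induction over integrable functions; a measurable set of finite measure is approximated from outside by open sets.\<close>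

theorem shift_modulus_tendsto_0:
  assumes "f \<in> L1" shows "(shift_modulus f \<longlongrightarrow> 0) (at 0)"
proof -
  have "integrable lborel f" using assms by (simp add: L1_def)
  then show ?thesis
  proof (induction rule: integrable_induct)
    case (base A c)
    then have [measurable]: "A \<in> sets borel" by simp
    have A: "(\<lambda>t. indicator A t *\<^sub>R c) \<in> L1"
      unfolding L1_def using base by (simp add: integrable_real_indicator)
    show ?case
    proof (rule shift_modulus_tendsto_approx[OF A])
      fix e :: real assume e: "e > 0"
      \<comment> \<open>the summand \<open>1\<close> covers \<open>c = 0\<close>\<close>
      define d where "d = e / (cmod c + 1)"
      have d: "d > 0" using e by (simp add: d_def add_nonneg_pos)
      obtain U where U: "open U" "A \<subseteq> U" "emeasure lborel (U - A) < d"
        using outer_regular_lborel[OF _ d, of A] by auto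
      have [measurable]: "U \<in> sets borel" using U by auto
      have "emeasure lborel U \<le> emeasure lborel A + emeasure lborel (U - A)"
        using U by (subst plus_emeasure) (auto simp: Un_absorb1)
      also have "\<dots> < \<infinity>"
        using base U(3) by (auto simp: ennreal_add_less_top intro: order.strict_trans)
      finally have fU: "emeasure lborel U < \<infinity>" .
      have fUA: "emeasure lborel (U - A) < \<infinity>"
        using U(3) by (auto intro: order.strict_trans)
      have "L1_norm (\<lambda>t. indicator A t *\<^sub>R c - indicator U t *\<^sub>R c) = (LINT t|lborel. cmod c * indicat_real (U - A) t)"
        unfolding L1_norm_def
        by (intro Bochner_Integration.integral_cong) (use U in \<open>auto simp: indicator_def\<close>)
      also have "\<dots> = cmod c * measure lborel (U - A)" by simp
      also have "\<dots> < e"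
      proof -
        have "measure lborel (U - A) \<le> d"
          using U(3) d by (simp add: measure_def enn2real_leI)
        then have "cmod c * measure lborel (U - A) \<le> cmod c * d"
          by (intro mult_left_mono) auto
        also have "\<dots> < (cmod c + 1) * d" using d by (simp add: algebra_simps)
        also have "\<dots> = e" unfolding d_def by (simp add: add_nonneg_eq_0_iff)
        finally show ?thesis .
      qed
      finally show "\<exists>g\<in>L1. L1_norm (\<lambda>t. indicator A t *\<^sub>R c - g t) < e \<and> (shift_modulus g \<longlongrightarrow> 0) (at 0)"
        using shift_modulus_indicator_open[OF U(1) fU] fU
        by (intro bexI[of _ "\<lambda>t. indicator U t *\<^sub>R c"]) (auto simp: L1_def integrable_real_indicator)
    qed
  next
    case (add f g)
    have le: "shift_modulus (\<lambda>t. f t + g t) s \<le> shift_modulus f s + shift_modulus g s" for s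
    proof -
      have "f \<in> L1" "g \<in> L1" using add by (simp_all add: L1_def)
      then have fs: "(\<lambda>t. f (t - s) - f t) \<in> L1" and gs: "(\<lambda>t. g (t - s) - g t) \<in> L1"
        by (auto intro!: L1_diff L1_translate)
      show ?thesis unfolding shift_modulus_def
        using L1_norm_triangle[OF fs gs] by (simp add: algebra_simps)
    qed
    show ?case
      by (rule tendsto_sandwich[OF _ _ tendsto_const tendsto_add_zero[OF add.IH]]) (auto simp: le)
  next
    case (lim f s)
    have f: "f \<in> L1" using lim by (simp add: L1_def)
    have s: "s i \<in> L1" for i using lim by (simp add: L1_def)
    have "(\<lambda>i. LINT t|lborel. cmod (f t - s i t)) \<longlonglongrightarrow> (LINT (t::real)|lborel. 0)"
    proof (rule integral_dominated_convergence[where w="\<lambda>t. 3 * cmod (f t)"])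
      show "AE t in lborel. (\<lambda>i. cmod (f t - s i t)) \<longlonglongrightarrow> 0"
      proof (rule AE_I2)
        fix t
        have "(\<lambda>i. f t - s i t) \<longlonglongrightarrow> f t - f t" by (intro tendsto_diff tendsto_const) (use lim in simp)
        then show "(\<lambda>i. cmod (f t - s i t)) \<longlonglongrightarrow> 0" by (intro tendsto_norm_zero) simp
      qed
      fix i
      show "AE t in lborel. norm (cmod (f t - s i t)) \<le> 3 * cmod (f t)"
      proof (rule AE_I2)
        fix t
        have "cmod (f t - s i t) \<le> cmod (f t) + cmod (s i t)" by (rule norm_triangle_ineq4)
        also have "cmod (s i t) \<le> 2 * cmod (f t)" using lim by simp
        finally show "norm (cmod (f t - s i t)) \<le> 3 * cmod (f t)" by simp
      qed
    qed (use f s in \<open>auto simp: L1_def\<close>)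
    then have L: "(\<lambda>i. L1_norm (\<lambda>t. f t - s i t)) \<longlonglongrightarrow> 0" by (simp add: L1_norm_def)
    show ?case
    proof (rule shift_modulus_tendsto_approx[OF f])
      fix e :: real assume "e > 0"
      then have "\<forall>\<^sub>F i in sequentially. L1_norm (\<lambda>t. f t - s i t) < e"
        by (rule order_tendstoD(2)[OF L])
      then obtain i where "L1_norm (\<lambda>t. f t - s i t) < e"
        by (auto simp: eventually_sequentially)
      then show "\<exists>g\<in>L1. L1_norm (\<lambda>t. f t - g t) < e \<and> (shift_modulus g \<longlongrightarrow> 0) (at 0)"
        using s[of i] lim.IH[of i] by (intro bexI[of _ "s i"]) simp_all
    qed
  qed
qed

section \<open>The Fourier transform and convolution\<close>

lemma norm_exp_i_real [simp]: "cmod (exp (\<i> * complex_of_real t * complex_of_real x)) = 1"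
    "cmod (exp (- (\<i> * complex_of_real t * complex_of_real x))) = 1"
  by (simp_all add: norm_exp_eq_Re)

lemma exp_i_minus_add:
  "exp (- (\<i> * complex_of_real (s + t) * complex_of_real x)) =
   exp (- (\<i> * of_real s * of_real x)) * exp (- (\<i> * of_real t * of_real x))"
  by (subst exp_add[symmetric], rule arg_cong[of _ _ exp]) (simp add: algebra_simps)

lemma exp_i_diff:
  "exp (\<i> * complex_of_real (t - s) * complex_of_real x) =
   exp (\<i> * of_real t * of_real x) * exp (- (\<i> * of_real s * of_real x))"
  by (subst exp_add[symmetric], rule arg_cong[of _ _ exp]) (simp add: algebra_simps)

lemma L1_modulate:
  assumes "f \<in> L1" shows "(\<lambda>t. exp (\<i> * of_real t * of_real c) * f t) \<in> L1"
proof -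
  have "integrable lborel f" using assms by (simp add: L1_def)
  moreover have "(\<lambda>t. exp (\<i> * of_real t * of_real c) * f t) \<in> borel_measurable lborel"
    using assms by measurable
  ultimately have "integrable lborel (\<lambda>t. exp (\<i> * of_real t * of_real c) * f t)"
    by (rule Bochner_Integration.integrable_bound[of lborel f]) (simp_all add: norm_mult)
  then show ?thesis by (simp add: L1_def)
qed

lemma integrable_fourier:
  assumes "f \<in> L1" shows "integrable lborel (\<lambda>t. f t * exp (- (\<i> * of_real t * of_real x)))"
  using L1_modulate[OF assms, of "- x"] by (simp add: L1_def mult.commute)

lemma fourier_add: "f \<in> L1 \<Longrightarrow> g \<in> L1 \<Longrightarrow> fourier (\<lambda>t. f t + g t) x = fourier f x + fourier g x"
  by (simp add: fourier_def distrib_right integrable_fourier)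

lemma fourier_diff: "f \<in> L1 \<Longrightarrow> g \<in> L1 \<Longrightarrow> fourier (\<lambda>t. f t - g t) x = fourier f x - fourier g x"
  by (simp add: fourier_def left_diff_distrib integrable_fourier)

lemma fourier_cmult: "fourier (\<lambda>t. c * f t) x = c * fourier f x"
  by (simp add: fourier_def mult.assoc)

lemma fourier_modulate: "fourier (\<lambda>t. exp (\<i> * of_real t * of_real c) * f t) x = fourier f (x - c)"
proof -
  have "exp (\<i> * of_real t * of_real c) * f t * exp (- (\<i> * of_real t * of_real x))
      = f t * exp (- (\<i> * of_real t * of_real (x - c)))" for t :: real
  proof -
    have "exp (- (\<i> * of_real t * of_real (x - c)))
        = exp (\<i> * complex_of_real t * of_real c) * exp (- (\<i> * of_real t * of_real x))"
      by (subst exp_add[symmetric], rule arg_cong[of _ _ exp]) (simp add: algebra_simps)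
    then show ?thesis by (simp only: mult_ac)
  qed
  then show ?thesis by (simp only: fourier_def)
qed

lemma fourier_dilate:
  assumes "a > 0" shows "fourier (\<lambda>t. of_real a * f (a * t)) x = fourier f (x / a)"
proof -
  have "fourier f (x / a) = \<bar>a\<bar> *\<^sub>R (LINT t|lborel. f (a * t) * exp (- (\<i> * of_real (a * t) * of_real (x / a))))"
    unfolding fourier_def
    using lborel_integral_real_affine[of a "\<lambda>t. f t * exp (- (\<i> * of_real t * of_real (x / a)))" 0] assms
    by simp
  also have "\<dots> = (LINT t|lborel. of_real a * (f (a * t) * exp (- (\<i> * of_real t * of_real x))))"
    using assms by (simp add: scaleR_conv_of_real mult.assoc)
  finally show ?thesis by (simp add: fourier_def mult.assoc)
qed

lemma continuous_fourier:
  assumes "f \<in> L1" shows "continuous_on UNIV (fourier f)"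
proof -
  have "isCont (fourier f) x" for x
    unfolding isCont_def tendsto_at_iff_sequentially o_def
  proof (intro allI impI)
    fix X :: "nat \<Rightarrow> real" assume X: "\<forall>i. X i \<in> UNIV - {x}" "X \<longlonglongrightarrow> x"
    have [measurable]: "f \<in> borel_measurable borel" using assms by measurable
    show "(\<lambda>n. fourier f (X n)) \<longlonglongrightarrow> fourier f x"
      unfolding fourier_def
    proof (rule integral_dominated_convergence[where w="\<lambda>t. cmod (f t)"])
      show "AE t in lborel. (\<lambda>i. f t * exp (- (\<i> * of_real t * of_real (X i))))
              \<longlonglongrightarrow> f t * exp (- (\<i> * of_real t * of_real x))"
        by (intro AE_I2 tendsto_intros X)
    qed (use assms in \<open>auto simp: L1_def norm_mult\<close>)
  qed
  then show ?thesis by (simp add: continuous_at_imp_continuous_on)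
qed

text \<open>Minkowski's inequality for integrals, in \<open>L\<^sup>1\<close>.\<close>

lemma L1_norm_integral_le:
  fixes F :: "real \<Rightarrow> real \<Rightarrow> complex"
  assumes F: "integrable (lborel \<Otimes>\<^sub>M lborel) (case_prod F)"
  shows "(\<lambda>t. LINT s|lborel. F s t) \<in> L1"
    and "L1_norm (\<lambda>t. LINT s|lborel. F s t) \<le> (LINT s|lborel. L1_norm (F s))"
proof -
  show 1: "(\<lambda>t. LINT s|lborel. F s t) \<in> L1"
    unfolding L1_def using lborel_pair.integrable_snd[OF F] by simp
  have n: "integrable (lborel \<Otimes>\<^sub>M lborel) (\<lambda>(s, t). cmod (F s t))"
    using integrable_norm[OF F] by (simp add: case_prod_unfold)
  have "L1_norm (\<lambda>t. LINT s|lborel. F s t) \<le> (LINT t|lborel. LINT s|lborel. cmod (F s t))"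
    unfolding L1_norm_def using 1 lborel_pair.integrable_snd[OF n]
    by (intro integral_mono integral_norm_bound) (auto simp: L1_def)
  also have "\<dots> = (LINT s|lborel. L1_norm (F s))"
    unfolding L1_norm_def by (rule lborel_pair.Fubini_integral[OF n])
  finally show "L1_norm (\<lambda>t. LINT s|lborel. F s t) \<le> (LINT s|lborel. L1_norm (F s))" .
qed

lemma integrable_convolution_kernel:
  assumes "f \<in> L1" "g \<in> L1"
  shows "integrable (lborel \<Otimes>\<^sub>M lborel) (\<lambda>(s, t). f (t - s) * g s)"
proof (rule lborel_pair.Fubini_integrable)
  have [measurable]: "f \<in> borel_measurable borel" "g \<in> borel_measurable borel" using assms by measurable
  show "(\<lambda>(s, t). f (t - s) * g s) \<in> borel_measurable (lborel \<Otimes>\<^sub>M lborel)" by measurable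
  have "(LINT t|lborel. norm (case (s, t) of (s, t) \<Rightarrow> f (t - s) * g s)) = cmod (g s) * L1_norm f" for s
    using L1_norm_translate[of f s] by (simp add: norm_mult L1_norm_def mult.commute)
  then show "integrable lborel (\<lambda>s. LINT t|lborel. norm (case (s, t) of (s, t) \<Rightarrow> f (t - s) * g s))"
    using assms by (simp add: L1_def)
  show "AE s in lborel. integrable lborel (\<lambda>t. case (s, t) of (s, t) \<Rightarrow> f (t - s) * g s)"
    using L1_translate[OF assms(1)] by (simp add: L1_def)
qed

lemma L1_convolution:
  assumes "f \<in> L1" "g \<in> L1" shows "convolution f g \<in> L1"
  unfolding convolution_def
  by (rule L1_norm_integral_le) (use integrable_convolution_kernel[OF assms] in simp)

lemma fourier_convolution:
  assumes "f \<in> L1" "g \<in> L1" shows "fourier (convolution f g) x = fourier f x * fourier g x"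
proof -
  let ?e = "\<lambda>t::real. exp (- (\<i> * of_real t * of_real x))"
  have [measurable]: "f \<in> borel_measurable borel" "g \<in> borel_measurable borel" using assms by measurable
  have I: "integrable (lborel \<Otimes>\<^sub>M lborel) (\<lambda>(s, t). f (t - s) * g s * ?e t)"
    by (rule Bochner_Integration.integrable_bound[OF integrable_convolution_kernel[OF assms]])
       (auto simp: norm_mult)
  have "fourier (convolution f g) x = (LINT t|lborel. LINT s|lborel. f (t - s) * g s * ?e t)"
    unfolding fourier_def convolution_def by simp
  also have "\<dots> = (LINT s|lborel. LINT t|lborel. f (t - s) * g s * ?e t)"
    by (rule lborel_pair.Fubini_integral[OF I])
  also have "\<dots> = (LINT s|lborel. fourier f x * (g s * ?e s))"
  proof (rule Bochner_Integration.integral_cong[OF refl])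
    fix s
    have "(LINT t|lborel. f (t - s) * g s * ?e t) = (LINT t|lborel. f (s + 1 * t - s) * g s * ?e (s + 1 * t))"
      by (subst lborel_integral_real_affine[where c=1 and t=s]) auto
    also have "\<dots> = (LINT t|lborel. (f t * ?e t) * (g s * ?e s))"
      by (intro Bochner_Integration.integral_cong refl, subst exp_i_minus_add) (simp add: mult_ac)
    finally show "(LINT t|lborel. f (t - s) * g s * ?e t) = fourier f x * (g s * ?e s)"
      by (simp add: fourier_def)
  qed
  finally show ?thesis by (simp add: fourier_def)
qed

lemma convolution_commute: "convolution f g = convolution g f"
proof
  fix t
  have "convolution f g t = (LINT s|lborel. f (t - (t + (-1) * s)) * g (t + (-1) * s))"
    unfolding convolution_def
    using lborel_integral_real_affine[of "-1" "\<lambda>s. f (t - s) * g s" t] by simp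
  then show "convolution f g t = convolution g f t"
    by (simp add: convolution_def mult.commute)
qed

section \<open>Convolution with concentrated kernels\<close>

lemma shift_modulus_measurable [measurable]:
  assumes [measurable]: "f \<in> borel_measurable borel"
  shows "shift_modulus f \<in> borel_measurable borel"
  unfolding shift_modulus_def L1_norm_def by measurable

lemma integrable_shift_modulus:
  assumes "f \<in> L1" "g \<in> L1"
  shows "integrable lborel (\<lambda>s. shift_modulus f (c * s) * cmod (g s))"
proof (rule Bochner_Integration.integrable_bound)
  have [measurable]: "f \<in> borel_measurable borel" "g \<in> borel_measurable borel" using assms by measurable
  show "(\<lambda>s. shift_modulus f (c * s) * cmod (g s)) \<in> borel_measurable lborel" by measurable
  show "integrable lborel (\<lambda>s. 2 * L1_norm f * cmod (g s))" using assms by (simp add: L1_def)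
  show "AE s in lborel. norm (shift_modulus f (c * s) * cmod (g s)) \<le> norm (2 * L1_norm f * cmod (g s))"
    using shift_modulus_le[OF assms(1)] by (intro AE_I2) (auto simp: abs_mult intro!: mult_right_mono)
qed

text \<open>The central estimate. Convolving \<open>F\<close> with \<open>g\<close> averages translates of \<open>F\<close> with weight \<open>g\<close>; if \<open>F\<close> is a
function \<open>f\<close> modulated to frequency \<open>x\<close>, a translation by \<open>s\<close> multiplies it by \<open>exp (- \<i> s x)\<close> up to an error
of norm \<open>shift_modulus f s\<close>, and the phases add up to the Fourier transform of \<open>g\<close> at \<open>x\<close>. With \<open>x = 0\<close> and a
concentrated \<open>g\<close> this yields approximate identities; with a very flat \<open>f\<close> it says that \<open>g\<close> acts almost like a scalar near
the frequency \<open>x\<close>.\<close>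

lemma convolution_modulated_estimate:
  fixes x :: real
  assumes f: "f \<in> L1" and g: "g \<in> L1"
  defines "F \<equiv> (\<lambda>t. exp (\<i> * of_real t * of_real x) * f t)"
  shows "L1_norm (\<lambda>t. convolution F g t - fourier g x * F t) \<le> (LINT s|lborel. shift_modulus f s * cmod (g s))"
proof -
  let ?e = "\<lambda>t::real. exp (- (\<i> * of_real t * of_real x))"
  have [measurable]: "f \<in> borel_measurable borel" "g \<in> borel_measurable borel" using assms by measurable
  have F: "F \<in> L1" unfolding F_def by (rule L1_modulate[OF f])
  have [measurable]: "F \<in> borel_measurable borel" using F by measurable
  define k where "k s t = (F (t - s) - ?e s * F t) * g s" for s t
  have k_eq: "cmod (k s t) = cmod (f (t - s) - f t) * cmod (g s)" for s t
  proof -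
    have "k s t = exp (\<i> * of_real t * of_real x) * ?e s * ((f (t - s) - f t) * g s)"
      unfolding k_def F_def exp_i_diff by (simp only: algebra_simps)
    then show ?thesis by (simp add: norm_mult)
  qed
  have nk: "L1_norm (k s) = shift_modulus f s * cmod (g s)" for s
    unfolding L1_norm_def k_eq shift_modulus_def by simp
  have I: "integrable (lborel \<Otimes>\<^sub>M lborel) (case_prod k)"
  proof (rule lborel_pair.Fubini_integrable)
    show "case_prod k \<in> borel_measurable (lborel \<Otimes>\<^sub>M lborel)" unfolding k_def by measurable
    show "integrable lborel (\<lambda>s. LINT t|lborel. norm (case (s, t) of (s, t) \<Rightarrow> k s t))"
      using integrable_shift_modulus[OF f g, of 1] nk by (simp add: L1_norm_def)
    have "(\<lambda>t. k s t) \<in> L1" for s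
    proof -
      have "(\<lambda>t. g s * (F (t - s) - ?e s * F t)) \<in> L1"
        by (intro L1_cmult L1_diff L1_translate F)
      then show ?thesis by (simp add: k_def mult.commute)
    qed
    then show "AE s in lborel. integrable lborel (\<lambda>t. case (s, t) of (s, t) \<Rightarrow> k s t)"
      by (simp add: L1_def)
  qed
  have "AE t in lborel. integrable lborel (\<lambda>s. F (t - s) * g s)"
    using lborel_pair.AE_integrable_snd[OF integrable_convolution_kernel[OF F g]] by simp
  then have "AE t in lborel. convolution F g t - fourier g x * F t = (LINT s|lborel. k s t)"
  proof eventually_elim
    case (elim t)
    have i: "integrable lborel (\<lambda>s. F t * (g s * ?e s))"
      using integrable_fourier[OF g, of x] by simp
    have "(LINT s|lborel. k s t) = (LINT s|lborel. F (t - s) * g s - F t * (g s * ?e s))"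
      by (intro Bochner_Integration.integral_cong refl) (simp add: k_def algebra_simps)
    also have "\<dots> = (LINT s|lborel. F (t - s) * g s) - (LINT s|lborel. F t * (g s * ?e s))"
      by (rule Bochner_Integration.integral_diff[OF elim i])
    finally show ?case by (simp add: convolution_def fourier_def)
  qed
  then have "L1_norm (\<lambda>t. convolution F g t - fourier g x * F t) = L1_norm (\<lambda>t. LINT s|lborel. k s t)"
    unfolding L1_norm_def
    using L1_convolution[OF F g] F L1_norm_integral_le(1)[OF I]
    by (intro integral_cong_AE) (auto simp: L1_def)
  also have "\<dots> \<le> (LINT s|lborel. shift_modulus f s * cmod (g s))"
    using L1_norm_integral_le(2)[OF I] nk by simp
  finally show ?thesis .
qed

text \<open>Dominated convergence, since the modulus of continuity is bounded and tends to \<open>0\<close> at \<open>0\<close>.\<close>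

lemma shift_modulus_integral_tendsto:
  assumes f: "f \<in> L1" and g: "g \<in> L1" and c: "c \<longlonglongrightarrow> 0"
  shows "(\<lambda>n::nat. LINT s|lborel. shift_modulus f (c n * s) * cmod (g s)) \<longlonglongrightarrow> 0"
proof -
  have [measurable]: "f \<in> borel_measurable borel" "g \<in> borel_measurable borel" using assms by measurable
  have "isCont (shift_modulus f) 0"
    using shift_modulus_tendsto_0[OF f] by (simp add: isCont_def shift_modulus_def[of f 0] L1_norm_def)
  then have *: "(\<lambda>n. shift_modulus f (c n * s)) \<longlonglongrightarrow> 0" for s
    using isCont_tendsto_compose[of 0 "shift_modulus f" "\<lambda>n. c n * s" sequentially] tendsto_mult_left_zero[OF c, of s]
    by (simp add: shift_modulus_def[of f 0] L1_norm_def)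
  have "(\<lambda>n::nat. LINT s|lborel. shift_modulus f (c n * s) * cmod (g s)) \<longlonglongrightarrow> (LINT (s::real)|lborel. 0)"
  proof (rule integral_dominated_convergence[where w="\<lambda>s. 2 * L1_norm f * cmod (g s)"])
    show "AE s in lborel. (\<lambda>n. shift_modulus f (c n * s) * cmod (g s)) \<longlonglongrightarrow> 0"
      by (intro AE_I2 tendsto_mult_left_zero *)
    show "AE s in lborel. norm (shift_modulus f (c n * s) * cmod (g s)) \<le> 2 * L1_norm f * cmod (g s)" for n
      using shift_modulus_le[OF f] by (intro AE_I2) (auto simp: abs_mult intro!: mult_right_mono)
  qed (use g in \<open>auto simp: L1_def\<close>)
  then show ?thesis by simp
qed

text \<open>The factor \<open>a\<close> preserves the integral; on the Fourier side the argument is divided by \<open>a\<close>.\<close>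

definition dilate :: "real \<Rightarrow> (real \<Rightarrow> complex) \<Rightarrow> real \<Rightarrow> complex" where
  "dilate a f = (\<lambda>t. of_real a * f (a * t))"

lemma L1_dilate: "f \<in> L1 \<Longrightarrow> a > 0 \<Longrightarrow> dilate a f \<in> L1"
  unfolding dilate_def using L1_affine[of f a 0] by (intro L1_cmult) auto

lemma L1_norm_dilate: "a > 0 \<Longrightarrow> L1_norm (dilate a f) = L1_norm f"
  unfolding dilate_def using L1_norm_affine[of a f 0] by (simp add: L1_norm_cmult)

lemma shift_modulus_dilate:
  assumes "a > 0" shows "shift_modulus (dilate a f) s = shift_modulus f (a * s)"
proof -
  have "(\<lambda>t. dilate a f (t - s) - dilate a f t) = dilate a (\<lambda>t. f (t - a * s) - f t)"
    by (simp add: dilate_def algebra_simps)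
  then show ?thesis using L1_norm_dilate[OF assms] by (simp add: shift_modulus_def)
qed

theorem approximate_identity:
  assumes f: "f \<in> L1" and k: "k \<in> L1" and k1: "fourier k 0 = 1" and a: "filterlim a at_top sequentially"
  shows "(\<lambda>n. L1_norm (\<lambda>t. convolution f (dilate (a n) k) t - f t)) \<longlonglongrightarrow> 0"
proof -
  have pos: "\<forall>\<^sub>F n in sequentially. a n > 0" using a by (simp add: filterlim_at_top_dense)
  have inv: "(\<lambda>n. inverse (a n)) \<longlonglongrightarrow> 0" using tendsto_inverse_0_at_top[OF a] .
  show ?thesis
  proof (rule tendsto_sandwich[OF _ _ tendsto_const shift_modulus_integral_tendsto[OF f k inv]])
    show "\<forall>\<^sub>F n in sequentially. L1_norm (\<lambda>t. convolution f (dilate (a n) k) t - f t)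
       \<le> (LINT s|lborel. shift_modulus f (inverse (a n) * s) * cmod (k s))"
      using pos
    proof eventually_elim
      case (elim n)
      have "fourier (dilate (a n) k) 0 = 1"
        using fourier_dilate[OF elim, of k 0] k1 by (simp add: dilate_def)
      then have "L1_norm (\<lambda>t. convolution f (dilate (a n) k) t - f t)
          \<le> (LINT s|lborel. shift_modulus f s * cmod (dilate (a n) k s))"
        using convolution_modulated_estimate[OF f L1_dilate[OF k elim], of 0] by simp
      also have "\<dots> = (LINT s|lborel. shift_modulus f (inverse (a n) * s) * cmod (k s))"
        using elim lborel_integral_real_affine[of "a n" "\<lambda>s. shift_modulus f (inverse (a n) * s) * cmod (k s)" 0]
        by (simp add: dilate_def norm_mult mult.assoc[symmetric] mult.commute[of "\<bar>_\<bar>"])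
           (simp add: mult_ac)
      finally show ?case .
    qed
  qed simp
qed

section \<open>Injectivity of the Fourier transform\<close>

text \<open>The Gaussian is, up to a constant, its own Fourier transform; this is the Fourier inversion formula for the
kernel that will approximate the identity.\<close>

lemma std_normal_density_eq_fourier:
  "complex_of_real (std_normal_density u) =
     of_real (1 / sqrt (2 * pi)) * (LINT x|lborel. of_real (std_normal_density x) * exp (\<i> * of_real (u * x)))"
proof -
  have "complex_of_real (exp (- u\<^sup>2 / 2)) = char std_normal_distribution u"
    by (simp add: char_std_normal_distribution)
  also have "\<dots> = (LINT x|lborel. std_normal_density x *\<^sub>R exp (\<i> * of_real (u * x)))"
    unfolding char_def by (subst integral_density) auto
  finally show ?thesis
    by (simp add: std_normal_density_def scaleR_conv_of_real)
qed

text \<open>Writing the rescaled Gaussian as a Fourier integral and exchanging the integrals, its convolution with \<open>f\<close> is an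
integral over values of the Fourier transform of \<open>f\<close>, hence \<open>0\<close>; but these convolutions approximate \<open>f\<close>.\<close>

theorem fourier_eq_0_imp_L1_norm_0:
  assumes f: "f \<in> L1" and f0: "\<And>x. fourier f x = 0"
  shows "L1_norm f = 0"
proof -
  define k where "k t = complex_of_real (std_normal_density t)" for t
  have k: "k \<in> L1"
    by (simp add: L1_def k_def[abs_def] integrable_of_real)
  have k1: "fourier k 0 = 1"
    by (simp add: fourier_def k_def)
  have [measurable]: "f \<in> borel_measurable borel" "k \<in> borel_measurable borel" using f k by measurable
  have conv0: "convolution f (dilate a k) t = 0" for a t
  proof -
    define F where "F x s = f s * k x * exp (\<i> * of_real (a * (t - s) * x))" for x s :: real
    have I: "integrable (lborel \<Otimes>\<^sub>M lborel) (case_prod F)"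
    proof (rule lborel_pair.Fubini_integrable)
      show "case_prod F \<in> borel_measurable (lborel \<Otimes>\<^sub>M lborel)" unfolding F_def by measurable
      have nF: "norm (F x s) = cmod (k x) * cmod (f s)" for x s
        by (simp add: F_def norm_mult norm_exp_eq_Re)
      show "integrable lborel (\<lambda>x. LINT s|lborel. norm (case (x, s) of (x, s) \<Rightarrow> F x s))"
        using k by (simp add: nF L1_def)
      have "integrable lborel (\<lambda>s. F x s)" for x
        by (rule Bochner_Integration.integrable_bound[of lborel "\<lambda>s. k x * f s"])
           (use f in \<open>auto simp: nF norm_mult L1_def F_def\<close>)
      then show "AE x in lborel. integrable lborel (\<lambda>s. case (x, s) of (x, s) \<Rightarrow> F x s)" by simp
    qed
    let ?c = "complex_of_real a * of_real (1 / sqrt (2 * pi))"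
    have "convolution f (dilate a k) t = (LINT s|lborel. dilate a k (t - s) * f s)"
      using convolution_commute[of f "dilate a k"] by (simp add: convolution_def)
    also have "\<dots> = (LINT s|lborel. ?c * (LINT x|lborel. F x s))"
    proof (rule Bochner_Integration.integral_cong[OF refl])
      fix s
      have "k (a * (t - s)) * f s = of_real (1 / sqrt (2 * pi)) * (LINT x|lborel. F x s)"
        unfolding k_def std_normal_density_eq_fourier[of "a * (t - s)"] F_def
        by (subst integral_mult_right_zero[symmetric], subst integral_mult_left_zero[symmetric], subst integral_mult_right_zero[symmetric])
           (simp add: mult_ac)
      then show "dilate a k (t - s) * f s = ?c * (LINT x|lborel. F x s)"
        by (simp add: dilate_def mult.assoc)
    qed
    also have "\<dots> = ?c * (LINT s|lborel. LINT x|lborel. F x s)" by simp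
    also have "(LINT s|lborel. LINT x|lborel. F x s) = (LINT x|lborel. LINT s|lborel. F x s)"
      by (rule lborel_pair.Fubini_integral[OF I])
    also have "\<dots> = (LINT x|lborel. k x * exp (\<i> * of_real (a * t * x)) * fourier f (a * x))"
    proof (rule Bochner_Integration.integral_cong[OF refl])
      fix x
      have "F x s = k x * exp (\<i> * of_real (a * t * x)) * (f s * exp (- (\<i> * of_real s * of_real (a * x))))" for s
      proof -
        have "exp (\<i> * complex_of_real (a * (t - s) * x))
            = exp (\<i> * of_real (a * t * x)) * exp (- (\<i> * of_real s * of_real (a * x)))"
          by (subst exp_add[symmetric], rule arg_cong[of _ _ exp]) (simp add: algebra_simps)
        then show ?thesis by (simp add: F_def)
      qed
      then show "(LINT s|lborel. F x s) = k x * exp (\<i> * of_real (a * t * x)) * fourier f (a * x)"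
        by (simp add: fourier_def)
    qed
    finally show ?thesis by (simp add: f0)
  qed
  have "(\<lambda>n. L1_norm (\<lambda>t. convolution f (dilate (real n) k) t - f t)) \<longlonglongrightarrow> 0"
    by (rule approximate_identity[OF f k k1 filterlim_real_sequentially])
  then have "(\<lambda>n::nat. L1_norm f) \<longlonglongrightarrow> 0"
    by (simp add: conv0 L1_norm_def)
  then show ?thesis by (simp add: LIMSEQ_const_iff)
qed

section \<open>The Fejer and de la Vallee Poussin kernels\<close>

definition tent :: "real \<Rightarrow> real" where "tent x = max 0 (1 - \<bar>x\<bar>)"

text \<open>At \<open>t = 0\<close> the quotient is \<open>0\<close> rather than the limit \<open>1/2\<close>, which is harmless on a null set.\<close>

definition fejer_profile :: "real \<Rightarrow> real" where "fejer_profile t = (1 - cos t) / t\<^sup>2"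

lemma fejer_profile_nonneg: "0 \<le> fejer_profile t"
  by (simp add: fejer_profile_def)

lemma fejer_profile_le: "fejer_profile t \<le> 4 * inverse (1 + t\<^sup>2)"
proof -
  have "\<bar>sin (t / 2)\<bar> \<le> \<bar>t / 2\<bar>" by (rule abs_sin_x_le_abs_x)
  then have "(sin (t / 2))\<^sup>2 \<le> (t / 2)\<^sup>2" using abs_le_square_iff by blast
  then have a: "1 - cos t \<le> t\<^sup>2 / 2" using cos_double_sin[of "t / 2"] by (simp add: power2_eq_square)
  have b: "1 - cos t \<le> 2" using cos_ge_minus_one[of t] by linarith
  show ?thesis
  proof (cases "t = 0")
    case False
    have "(1 - cos t) * (1 + t\<^sup>2) = (1 - cos t) + (1 - cos t) * t\<^sup>2" by (simp add: algebra_simps)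
    also have "\<dots> \<le> t\<^sup>2 / 2 + 2 * t\<^sup>2" using a b by (intro add_mono mult_right_mono) auto
    also have "\<dots> \<le> 4 * t\<^sup>2" by simp
    finally show ?thesis using False
      by (simp add: fejer_profile_def divide_simps add_pos_nonneg)
  qed (simp add: fejer_profile_def)
qed

lemma fejer_profile_measurable [measurable]: "fejer_profile \<in> borel_measurable borel"
  unfolding fejer_profile_def by measurable

lemma integrable_fejer_profile: "integrable lborel fejer_profile"
proof (rule Bochner_Integration.integrable_bound)
  show "integrable lborel (\<lambda>t. 4 * inverse (1 + t\<^sup>2) :: real)"
    using integrable_inverse_1_plus_square by (simp add: set_integrable_def)
  show "AE t in lborel. norm (fejer_profile t) \<le> norm (4 * inverse (1 + t\<^sup>2))"
    using fejer_profile_le fejer_profile_nonneg by (intro AE_I2) (auto intro: order_trans)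
qed simp

text \<open>The value is \<open>\<pi>\<close>; it is kept symbolic because it cancels in the Fourier transform of the normalised kernel.\<close>

definition fejer_mass :: real where "fejer_mass = (LINT t|lborel. fejer_profile t)"

lemma fejer_mass_pos: "fejer_mass > 0"
proof -
  have "(LINT t|lborel. indicat_real {pi/2..pi} t * (1 / pi\<^sup>2)) \<le> fejer_mass"
    unfolding fejer_mass_def
  proof (rule integral_mono[OF _ integrable_fejer_profile])
    show "integrable lborel (\<lambda>t. indicat_real {pi/2..pi} t * (1 / pi\<^sup>2))"
      by (intro integrable_mult_left integrable_real_indicator) auto
    fix t
    show "indicat_real {pi/2..pi} t * (1 / pi\<^sup>2) \<le> fejer_profile t"
    proof (cases "t \<in> {pi/2..pi}")
      case True
      have "pi / 2 \<le> t" using True by simp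
      then have "0 < t" using pi_gt_zero by linarith
      moreover have "cos t \<le> 0" using cos_monotone_0_pi_le[of "pi/2" t] True by simp
      moreover have "t\<^sup>2 \<le> pi\<^sup>2" using True \<open>0 < t\<close> by (intro power_mono) auto
      ultimately have "1 / pi\<^sup>2 \<le> (1 - cos t) / t\<^sup>2" by (intro frac_le) auto
      then show ?thesis using True by (simp add: fejer_profile_def)
    qed (simp add: fejer_profile_nonneg)
  qed
  moreover have "(LINT t|lborel. indicat_real {pi/2..pi} t * (1 / pi\<^sup>2)) > 0" by simp
  ultimately show ?thesis by linarith
qed

text \<open>By substitution the integral is homogeneous in \<open>\<bar>a\<bar>\<close>.\<close>

lemma has_bochner_integral_1_minus_cos:
  "has_bochner_integral lborel (\<lambda>t. (1 - cos (a * t)) / t\<^sup>2) (fejer_mass * \<bar>a\<bar>)"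
proof (cases "a = 0")
  case False
  have eq: "(\<lambda>t. (1 - cos (a * t)) / t\<^sup>2) = (\<lambda>t. a\<^sup>2 * fejer_profile (0 + a * t))"
    using False by (auto simp: fejer_profile_def power_mult_distrib)
  have "integrable lborel (\<lambda>t. fejer_profile (0 + a * t))"
    using False integrable_fejer_profile by (subst lborel_integrable_real_affine_iff) auto
  moreover have "(LINT t|lborel. a\<^sup>2 * fejer_profile (0 + a * t)) = fejer_mass * \<bar>a\<bar>"
  proof -
    have *: "fejer_mass = \<bar>a\<bar> * (LINT t|lborel. fejer_profile (0 + a * t))"
      unfolding fejer_mass_def using lborel_integral_real_affine[OF False, of fejer_profile 0] by simp
    have "a\<^sup>2 = \<bar>a\<bar> * \<bar>a\<bar>" by (simp add: power2_eq_square)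
    then show ?thesis unfolding * by (simp del: abs_mult_self_eq)
  qed
  ultimately show ?thesis
    unfolding eq has_bochner_integral_iff by simp
qed (simp add: has_bochner_integral_zero)

definition fejer :: "real \<Rightarrow> complex" where
  "fejer t = of_real (fejer_profile t / fejer_mass)"

lemma fejer_L1: "fejer \<in> L1"
  using integrable_fejer_profile by (simp add: L1_def fejer_def[abs_def] integrable_of_real)

text \<open>A tent is half the second difference of the absolute value. This turns the product formula for cosines into the Fourier
transform of the Fejer kernel, and makes sums of shifted tents telescope.\<close>

lemma tent_eq: "tent x = \<bar>x + 1\<bar> / 2 + \<bar>x - 1\<bar> / 2 - \<bar>x\<bar>"
  by (auto simp: tent_def max_def abs_if field_simps)

text \<open>Only the even part of the exponential contributes, and \<open>(1 - cos t) cos (t x)\<close> is a combination of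
\<open>1 - cos (a t)\<close> with \<open>a = x + 1, x - 1, x\<close>, whose integrals are known.\<close>

lemma fourier_fejer: "fourier fejer x = of_real (tent x)"
proof -
  let ?e = "\<lambda>t. fejer t * exp (- (\<i> * of_real t * of_real x))"
  have i1: "integrable lborel ?e" by (rule integrable_fourier[OF fejer_L1])
  have i2: "integrable lborel (\<lambda>t. ?e (0 + (-1) * t))"
    using i1 by (subst lborel_integrable_real_affine_iff) auto
  have r: "fourier fejer x = (LINT t|lborel. ?e (0 + (-1) * t))"
    unfolding fourier_def using lborel_integral_real_affine[of "-1" ?e 0] by simp
  have "2 * fourier fejer x = (LINT t|lborel. ?e t + ?e (0 + (-1) * t))"
    using Bochner_Integration.integral_add[OF i1 i2] r by (simp add: fourier_def)
  also have "\<dots> = (LINT t|lborel. of_real (2 * (fejer_profile t / fejer_mass * cos (t * x))))"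
  proof (rule Bochner_Integration.integral_cong[OF refl])
    fix t
    have "?e t + ?e (0 + (-1) * t) = fejer t * (exp (- (\<i> * of_real (t * x))) + exp (\<i> * of_real (t * x)))"
      by (simp add: fejer_def fejer_profile_def algebra_simps)
    also have "exp (- (\<i> * complex_of_real (t * x))) + exp (\<i> * of_real (t * x)) = 2 * of_real (cos (t * x))"
      by (simp only: cos_of_real[symmetric] cos_exp_eq) (simp add: add.commute)
    finally show "?e t + ?e (0 + (-1) * t) = of_real (2 * (fejer_profile t / fejer_mass * cos (t * x)))"
      by (simp add: fejer_def)
  qed
  also have "\<dots> = of_real (2 * ((LINT t|lborel. fejer_profile t * cos (t * x)) / fejer_mass))"
  proof -
    have "(LINT t|lborel. 2 * (fejer_profile t / fejer_mass * cos (t * x))) =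
        (LINT t|lborel. 2 / fejer_mass * (fejer_profile t * cos (t * x)))"
      by (simp add: mult_ac)
    also have "\<dots> = 2 * ((LINT t|lborel. fejer_profile t * cos (t * x)) / fejer_mass)"
      by (simp only: integral_mult_right_zero) simp
    finally show ?thesis by (simp only: integral_complex_of_real)
  qed
  also have "(LINT t|lborel. fejer_profile t * cos (t * x)) = fejer_mass * tent x"
  proof -
    note I = has_bochner_integral_1_minus_cos
    have "has_bochner_integral lborel (\<lambda>t. (1 - cos ((x + 1) * t)) / t\<^sup>2 * (1/2) + (1 - cos ((x - 1) * t)) / t\<^sup>2 * (1/2)
            - (1 - cos (x * t)) / t\<^sup>2)
          (fejer_mass * \<bar>x + 1\<bar> * (1/2) + fejer_mass * \<bar>x - 1\<bar> * (1/2) - fejer_mass * \<bar>x\<bar>)"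
      by (intro has_bochner_integral_diff has_bochner_integral_add has_bochner_integral_mult_left I)
    also have "(\<lambda>t. (1 - cos ((x + 1) * t)) / t\<^sup>2 * (1/2) + (1 - cos ((x - 1) * t)) / t\<^sup>2 * (1/2)
            - (1 - cos (x * t)) / t\<^sup>2) = (\<lambda>t. fejer_profile t * cos (t * x))"
    proof
      fix t
      show "(1 - cos ((x + 1) * t)) / t\<^sup>2 * (1/2) + (1 - cos ((x - 1) * t)) / t\<^sup>2 * (1/2)
            - (1 - cos (x * t)) / t\<^sup>2 = fejer_profile t * cos (t * x)"
        by (cases "t = 0") (simp_all add: fejer_profile_def distrib_right left_diff_distrib cos_add cos_diff field_simps)
    qed
    finally show ?thesis
      by (simp add: has_bochner_integral_iff tent_eq algebra_simps)
  qed
  finally show ?thesis using fejer_mass_pos by simp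
qed

lemma tau_eq_tent: "a > 0 \<Longrightarrow> tau a x = 2 * tent (x / (2 * a)) - tent (x / a)"
  by (auto simp: tau_def tent_def max_def abs_divide field_simps)

text \<open>The combination of two Fejer kernels whose Fourier transform is the trapezoid \<open>tau 1\<close>, which equals \<open>1\<close> on
an interval and so can serve as a local unit.\<close>

definition vallee_poussin :: "real \<Rightarrow> complex" where
  "vallee_poussin t = 2 * dilate 2 fejer t - fejer t"

lemma vallee_poussin_L1: "vallee_poussin \<in> L1"
  unfolding vallee_poussin_def by (intro L1_diff L1_cmult L1_dilate fejer_L1) simp

lemma fourier_vallee_poussin: "fourier vallee_poussin x = of_real (tau 1 x)"
proof -
  have "fourier vallee_poussin x = 2 * fourier (dilate 2 fejer) x - fourier fejer x"
    unfolding vallee_poussin_def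
    by (subst fourier_diff) (auto intro!: L1_cmult L1_dilate fejer_L1 simp: fourier_cmult)
  also have "fourier (dilate 2 fejer) x = of_real (tent (x / 2))"
    using fourier_dilate[of 2 fejer x] by (simp add: dilate_def fourier_fejer)
  finally show ?thesis by (simp add: fourier_fejer tau_eq_tent)
qed

section \<open>The algebra of Fourier transforms\<close>

lemma FL1_I: "f \<in> L1 \<Longrightarrow> fourier f \<in> FL1"
  by (simp add: FL1_def)

lemma inv_fourier:
  assumes "m \<in> FL1" shows inv_fourier_L1: "inv_fourier m \<in> L1" and fourier_inv_fourier: "fourier (inv_fourier m) = m"
proof -
  have "\<exists>f. f \<in> L1 \<and> fourier f = m" using assms by (auto simp: FL1_def)
  then have "inv_fourier m \<in> L1 \<and> fourier (inv_fourier m) = m"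
    unfolding inv_fourier_def by (rule someI_ex)
  then show "inv_fourier m \<in> L1" "fourier (inv_fourier m) = m" by auto
qed

lemma FL1_eqI:
  assumes "f \<in> L1" "\<And>x. fourier f x = m x" shows "m \<in> FL1"
proof -
  have "fourier f = m" by (rule ext) (rule assms(2))
  then show ?thesis using FL1_I[OF assms(1)] by simp
qed

lemma FL1_add: "m \<in> FL1 \<Longrightarrow> n \<in> FL1 \<Longrightarrow> (\<lambda>x. m x + n x) \<in> FL1"
  by (rule FL1_eqI[of "\<lambda>t. inv_fourier m t + inv_fourier n t"])
     (simp_all add: L1_add fourier_add inv_fourier)

lemma FL1_diff: "m \<in> FL1 \<Longrightarrow> n \<in> FL1 \<Longrightarrow> (\<lambda>x. m x - n x) \<in> FL1"
  by (rule FL1_eqI[of "\<lambda>t. inv_fourier m t - inv_fourier n t"])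
     (simp_all add: L1_diff fourier_diff inv_fourier)

lemma FL1_cmult: "m \<in> FL1 \<Longrightarrow> (\<lambda>x. c * m x) \<in> FL1"
  by (rule FL1_eqI[of "\<lambda>t. c * inv_fourier m t"])
     (simp_all add: L1_cmult fourier_cmult inv_fourier)

lemma FL1_times: "m \<in> FL1 \<Longrightarrow> n \<in> FL1 \<Longrightarrow> (\<lambda>x. m x * n x) \<in> FL1"
  by (rule FL1_eqI[of "convolution (inv_fourier m) (inv_fourier n)"])
     (simp_all add: L1_convolution fourier_convolution inv_fourier)

lemma FL1_continuous: "m \<in> FL1 \<Longrightarrow> continuous_on UNIV m"
  by (auto simp: FL1_def continuous_fourier)

lemma fourier_modulated_dilate:
  assumes "d > 0"
  shows "fourier (\<lambda>t. exp (\<i> * of_real t * of_real c) * dilate d f t) = (\<lambda>x. fourier f ((x - c) / d))"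
  using fourier_dilate[OF assms, of f] by (auto simp: fourier_modulate dilate_def)

lemma FL1_rescale:
  assumes "m \<in> FL1" "d > 0" shows "(\<lambda>x. m ((x - c) / d)) \<in> FL1"
proof -
  obtain f where f: "f \<in> L1" "m = fourier f" using assms by (auto simp: FL1_def)
  have "(\<lambda>t. exp (\<i> * of_real t * of_real c) * dilate d f t) \<in> L1"
    by (intro L1_modulate L1_dilate f assms)
  from FL1_I[OF this] show ?thesis
    by (simp add: fourier_modulated_dilate[OF assms(2)] f(2))
qed

lemma FL1_tent: "d > 0 \<Longrightarrow> (\<lambda>x. of_real (tent ((x - c) / d))) \<in> FL1"
  using FL1_rescale[OF FL1_I[OF fejer_L1], of d c] by (simp add: fourier_fejer)

lemma FL1_tau1: "d > 0 \<Longrightarrow> (\<lambda>x. of_real (tau 1 ((x - c) / d))) \<in> FL1"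
  using FL1_rescale[OF FL1_I[OF vallee_poussin_L1], of d c] by (simp add: fourier_vallee_poussin)

text \<open>Compact support, with an explicit radius.\<close>

definition band_limited :: "(real \<Rightarrow> complex) \<Rightarrow> bool" where
  "band_limited m \<longleftrightarrow> (\<exists>R. \<forall>x. R \<le> \<bar>x\<bar> \<longrightarrow> m x = 0)"

lemma supp_closed: "closed (supp m)" by (simp add: supp_def)

lemma compact_supp_iff: "compact (supp m) \<longleftrightarrow> band_limited m"
proof
  assume "compact (supp m)"
  then have "bounded (supp m)" by (rule compact_imp_bounded)
  then obtain R where R: "\<forall>x\<in>supp m. \<bar>x\<bar> \<le> R"
    by (auto simp: bounded_iff)
  have "m x = 0" if "R + 1 \<le> \<bar>x\<bar>" for x
    using R that closure_subset[of "{x. m x \<noteq> 0}"] by (force simp: supp_def)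
  then show "band_limited m" by (auto simp: band_limited_def)
next
  assume "band_limited m"
  then obtain R where "\<And>x. R \<le> \<bar>x\<bar> \<Longrightarrow> m x = 0" by (auto simp: band_limited_def)
  then have "{x. m x \<noteq> 0} \<subseteq> cball 0 R" by (force simp: dist_norm)
  then have "supp m \<subseteq> cball 0 R" unfolding supp_def by (rule closure_minimal) simp
  then show "compact (supp m)"
    using supp_closed bounded_subset[OF bounded_cball] by (auto simp: compact_eq_bounded_closed)
qed

lemma FL1_loc_iff: "h \<in> FL1_loc \<longleftrightarrow> (\<forall>m\<in>FL1. band_limited m \<longrightarrow> (\<lambda>x. h x * m x) \<in> FL1)"
  by (auto simp: FL1_loc_def FL1_def compact_supp_iff)

lemma band_limited_times: "band_limited m \<Longrightarrow> band_limited (\<lambda>x. m x * n x)"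
  by (auto simp: band_limited_def)

lemma tent_eq_0: "1 \<le> \<bar>x\<bar> \<Longrightarrow> tent x = 0" by (simp add: tent_def)

lemma tau1_eq_1: "\<bar>x\<bar> \<le> 1 \<Longrightarrow> tau 1 x = 1" by (simp add: tau_def)

lemma tau1_eq_0: "2 \<le> \<bar>x\<bar> \<Longrightarrow> tau 1 x = 0" by (simp add: tau_def)

lemma band_limited_tent:
  assumes "d > 0" shows "band_limited (\<lambda>x. of_real (tent ((x - c) / d)))"
  unfolding band_limited_def
proof (intro exI[of _ "d + \<bar>c\<bar>"] allI impI)
  fix x assume "d + \<bar>c\<bar> \<le> \<bar>x\<bar>"
  then have "1 \<le> \<bar>(x - c) / d\<bar>" using assms by (simp add: abs_divide field_simps)
  then show "complex_of_real (tent ((x - c) / d)) = 0" by (simp add: tent_eq_0)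
qed

lemma band_limited_tau1:
  assumes "d > 0" shows "band_limited (\<lambda>x. of_real (tau 1 ((x - c) / d)))"
  unfolding band_limited_def
proof (intro exI[of _ "2 * d + \<bar>c\<bar>"] allI impI)
  fix x assume "2 * d + \<bar>c\<bar> \<le> \<bar>x\<bar>"
  then have "2 \<le> \<bar>(x - c) / d\<bar>" using assms by (simp add: abs_divide field_simps)
  then show "complex_of_real (tau 1 ((x - c) / d)) = 0" by (simp add: tau1_eq_0)
qed

section \<open>Non-degenerate modules and approximate identities\<close>

lemma scaleC_zero_right [simp]: "c *\<^sub>C (0::'a::complex_banach) = 0"
  using scaleC_add_right[of c 0 "0::'a"] by simp

lemma scaleC_minus_one: "(- 1) *\<^sub>C (x::'a::complex_banach) = - x"
  using scaleC_of_real[of "-1" x] by simp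

lemma bounded_linear_scaleC: "bounded_linear (\<lambda>x::'a::complex_banach. c *\<^sub>C x)"
proof (rule bounded_linear_intro[where K="cmod c"])
  show "c *\<^sub>C (r *\<^sub>R x) = r *\<^sub>R (c *\<^sub>C x)" for r and x :: 'a
    by (simp add: scaleC_of_real[symmetric] scaleC_scaleC mult.commute)
qed (simp_all add: scaleC_add_right norm_scaleC mult.commute)

lemmas tendsto_scaleC = bounded_linear.tendsto[OF bounded_linear_scaleC]

text \<open>Half-open, so that a pulse is exactly the average of two disjoint pulses of half its width.\<close>

definition pulse :: "real \<Rightarrow> complex" where "pulse t = of_real (indicat_real {0..<1} t)"

lemma pulse_L1: "pulse \<in> L1"
  unfolding L1_def pulse_def[abs_def] by (simp add: integrable_of_real)

lemma fourier_pulse_0: "fourier pulse 0 = 1"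
  by (simp add: fourier_def pulse_def)

lemma L1_norm_pulse: "L1_norm pulse = 1"
  by (simp add: L1_norm_def pulse_def)

locale L1_module =
  fixes act :: "(real \<Rightarrow> complex) \<Rightarrow> 'x::complex_banach \<Rightarrow> 'x"
    and T :: "real \<Rightarrow> 'x \<Rightarrow> 'x"
  assumes module: "banach_L1_module act"
    and nondeg: "nondegenerate act"
    and isometric: "isometric_representation T"
    and strong_cont: "strongly_continuous T"
    and assoc: "associated act T"
begin

lemma act_add: "f \<in> L1 \<Longrightarrow> g \<in> L1 \<Longrightarrow> act (\<lambda>t. f t + g t) x = act f x + act g x"
  and act_cmult: "f \<in> L1 \<Longrightarrow> act (\<lambda>t. c * f t) x = c *\<^sub>C act f x"
  and act_add_right: "f \<in> L1 \<Longrightarrow> act f (x + y) = act f x + act f y"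
  and act_scaleC_right: "f \<in> L1 \<Longrightarrow> act f (c *\<^sub>C x) = c *\<^sub>C act f x"
  and act_convolution: "f \<in> L1 \<Longrightarrow> g \<in> L1 \<Longrightarrow> act (convolution f g) x = act f (act g x)"
  and norm_act_le: "f \<in> L1 \<Longrightarrow> norm (act f x) \<le> L1_norm f * norm x"
  using module by (auto simp: banach_L1_module_def)

lemma act_translate: "f \<in> L1 \<Longrightarrow> act (\<lambda>s. f (t + s)) x = act f (T t x)"
  using assoc by (simp add: associated_def)

lemma act_diff:
  assumes "f \<in> L1" "g \<in> L1" shows "act (\<lambda>t. f t - g t) x = act f x - act g x"
  using act_add[OF assms(1) L1_cmult[OF assms(2), of "-1"]] act_cmult[OF assms(2), of "-1"]
  by (simp add: scaleC_minus_one)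

lemma bounded_linear_act: "f \<in> L1 \<Longrightarrow> bounded_linear (act f)"
proof (rule bounded_linear_intro[where K="L1_norm f"])
  assume f: "f \<in> L1"
  show "act f (r *\<^sub>R x) = r *\<^sub>R act f x" for r x
    using act_scaleC_right[OF f, of "of_real r"] by (simp add: scaleC_of_real)
qed (simp_all add: act_add_right norm_act_le mult.commute)

lemma act_diff_right: "f \<in> L1 \<Longrightarrow> act f (x - y) = act f x - act f y"
  using bounded_linear.linear[OF bounded_linear_act] by (rule linear_diff)

lemma act_commute: "f \<in> L1 \<Longrightarrow> g \<in> L1 \<Longrightarrow> act f (act g x) = act g (act f x)"
  using act_convolution[of f g] act_convolution[of g f] by (simp add: convolution_commute[of f g])

text \<open>Integrable functions with the same Fourier transform act in the same way. In particular the choice of representative made by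
\<open>inv_fourier\<close> is irrelevant.\<close>

lemma act_cong_fourier:
  assumes "f \<in> L1" "g \<in> L1" "\<And>x. fourier f x = fourier g x"
  shows "act f x = act g x"
proof -
  have "L1_norm (\<lambda>t. f t - g t) = 0"
    using assms by (intro fourier_eq_0_imp_L1_norm_0 L1_diff) (simp_all add: fourier_diff)
  then have "norm (act (\<lambda>t. f t - g t) x) \<le> 0"
    using norm_act_le[OF L1_diff[OF assms(1,2)], of x] by simp
  then show ?thesis by (simp add: act_diff assms)
qed

lemma act_pulse_halve:
  assumes "a > 0"
  shows "act (dilate a pulse) x = (1 / 2) *\<^sub>R (act (dilate (2 * a) pulse) x + act (dilate (2 * a) pulse) (T (- (1 / (2 * a))) x))"
proof -
  let ?f = "dilate (2 * a) pulse"
  have f: "?f \<in> L1" using assms by (intro L1_dilate pulse_L1) simp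
  have g: "(\<lambda>s. ?f (- (1 / (2 * a)) + s)) \<in> L1"
    using L1_translate[OF f, of "1 / (2 * a)"] by simp
  have "dilate a pulse = (\<lambda>t. of_real (1 / 2) * (?f t + ?f (- (1 / (2 * a)) + t)))"
  proof
    fix t
    have "2 * a * (- (1 / (2 * a)) + t) = 2 * (a * t) - 1" using assms by (simp add: field_simps)
    then show "dilate a pulse t = of_real (1 / 2) * (?f t + ?f (- (1 / (2 * a)) + t))"
      unfolding dilate_def by (auto simp: pulse_def indicator_def)
  qed
  then have "act (dilate a pulse) x = act (\<lambda>t. of_real (1 / 2) * (?f t + ?f (- (1 / (2 * a)) + t))) x"
    by (simp only:)
  also have "\<dots> = of_real (1 / 2) *\<^sub>C act (\<lambda>t. ?f t + ?f (- (1 / (2 * a)) + t)) x"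
    by (rule act_cmult[OF L1_add[OF f g]])
  also have "act (\<lambda>t. ?f t + ?f (- (1 / (2 * a)) + t)) x = act ?f x + act (\<lambda>s. ?f (- (1 / (2 * a)) + s)) x"
    by (rule act_add[OF f g])
  finally show ?thesis by (simp only: scaleC_of_real act_translate[OF f])
qed

lemma T_0: "T 0 x = x" and T_add: "T (s + t) x = T s (T t x)"
  using isometric by (simp_all add: isometric_representation_def)

text \<open>The pulse of width \<open>1 / a\<close> is an average of \<open>2 ^ k\<close> translates of narrow pulses, and translating
the function amounts to applying \<open>T\<close> to the vector. So the wide pulse acts on \<open>x\<close> as an average of the narrow pulse
applied to the vectors \<open>T (- s) x\<close> with \<open>0 \<le> s < 1 / a\<close>. Allowing a vector \<open>z\<close> other than \<open>x\<close> makes the induction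
go through, as the second half of the pulse leads from \<open>x\<close> to a translate of \<open>x\<close>.\<close>

lemma act_pulse_close:
  assumes "a > 0" and "\<And>s. 0 \<le> s \<Longrightarrow> s < 1 / a \<Longrightarrow> norm (T (- s) x - z) \<le> e"
  shows "norm (act (dilate a pulse) x - act (dilate (2 ^ k * a) pulse) z) \<le> e"
  using assms
proof (induction k arbitrary: a x)
  case 0
  have L: "dilate a pulse \<in> L1" using 0(1) by (intro L1_dilate pulse_L1)
  have "norm (act (dilate a pulse) (x - z)) \<le> norm (x - z)"
    using norm_act_le[OF L, of "x - z"] L1_norm_dilate[OF 0(1), of pulse] by (simp add: L1_norm_pulse)
  also have "\<dots> \<le> e" using 0(2)[of 0] 0(1) by (simp add: T_0)
  finally show ?case
    by (simp add: act_diff_right[OF L])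
next
  case (Suc k)
  let ?h = "1 / (2 * a)"
  let ?z = "act (dilate (2 ^ Suc k * a) pulse) z"
  have 1: "norm (act (dilate (2 * a) pulse) y - ?z) \<le> e"
    if "\<And>s. 0 \<le> s \<Longrightarrow> s < ?h \<Longrightarrow> norm (T (- s) y - z) \<le> e" for y
    using Suc.IH[of "2 * a" y] that Suc.prems(1) by (simp add: mult_ac)
  have 2: "norm (act (dilate (2 * a) pulse) x - ?z) \<le> e"
    using Suc.prems by (intro 1 Suc.prems(2)) (auto simp: field_simps)
  have 3: "norm (act (dilate (2 * a) pulse) (T (- ?h) x) - ?z) \<le> e"
  proof (rule 1)
    fix s assume "0 \<le> s" "s < ?h"
    then have "norm (T (- (s + ?h)) x - z) \<le> e"
      using Suc.prems(1) by (intro Suc.prems(2)) (auto simp: field_simps)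
    then show "norm (T (- s) (T (- ?h) x) - z) \<le> e"
      using T_add[of "- s" "- ?h" x] by (simp add: algebra_simps)
  qed
  have "act (dilate a pulse) x - ?z
      = (1 / 2) *\<^sub>R ((act (dilate (2 * a) pulse) x - ?z) + (act (dilate (2 * a) pulse) (T (- ?h) x) - ?z))"
    unfolding act_pulse_halve[OF Suc.prems(1)] by (simp add: algebra_simps flip: scaleR_add_left)
  also have "norm \<dots> \<le> (1 / 2) * (e + e)"
    using norm_triangle_mono[OF 2 3] by simp
  finally show ?case by simp
qed

text \<open>Strong continuity makes the sequence Cauchy by the preceding estimate. The
limit \<open>z\<close> satisfies \<open>act f z = act f x\<close> for all \<open>f\<close>, because the pulses are an approximate identity of the convolution
algebra, and then \<open>z = x\<close> by non-degeneracy.\<close>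

lemma act_pulse_tendsto: "(\<lambda>n. act (dilate (2 ^ n) pulse) x) \<longlonglongrightarrow> x"
proof -
  define u where "u n = act (dilate (2 ^ n) pulse) x" for n
  have L: "dilate (2 ^ n) pulse \<in> L1" for n :: nat by (intro L1_dilate pulse_L1) simp
  have "Cauchy u"
  proof (rule CauchyI')
    fix e :: real assume e: "e > 0"
    have "(\<lambda>t. T t x) \<midarrow>0\<rightarrow> T 0 x"
      using strong_cont by (auto simp: strongly_continuous_def continuous_on_eq_continuous_at isCont_def)
    from LIM_D[OF this, of "e / 2"] obtain d
      where d: "d > 0" "\<And>t. t \<noteq> 0 \<Longrightarrow> \<bar>t\<bar> < d \<Longrightarrow> norm (T t x - x) < e / 2"
      using e by (auto simp: T_0)
    obtain M where M: "(1 / 2) ^ M < d" using real_arch_pow_inv[of d "1/2"] d by auto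
    show "\<exists>M. \<forall>m\<ge>M. \<forall>n>m. dist (u m) (u n) < e"
    proof (intro exI allI impI)
      fix m n assume mn: "M \<le> m" "m < n"
      have "1 / 2 ^ m \<le> (1 / 2 :: real) ^ M"
        using mn by (simp add: power_one_over[symmetric] power_decreasing)
      then have "norm (T (- s) x - x) \<le> e / 2" if "0 \<le> s" "s < 1 / 2 ^ m" for s
        using that M d(2)[of "- s"] e by (cases "s = 0") (auto simp: T_0)
      then have "norm (act (dilate (2 ^ m) pulse) x - act (dilate (2 ^ (n - m) * 2 ^ m) pulse) x) \<le> e / 2"
        by (intro act_pulse_close) auto
      then show "dist (u m) (u n) < e"
        using e mn by (simp add: u_def dist_norm flip: power_add)
    qed
  qed
  then obtain z where z: "u \<longlonglongrightarrow> z" using Cauchy_convergent_iff convergent_def by blast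
  have "act f (z - x) = 0" if f: "f \<in> L1" for f
  proof -
    have "(\<lambda>n. act (convolution f (dilate (2 ^ n) pulse)) x - act f x) \<longlonglongrightarrow> 0"
    proof (rule Lim_null_comparison)
      show "\<forall>\<^sub>F n in sequentially. norm (act (convolution f (dilate (2 ^ n) pulse)) x - act f x)
          \<le> L1_norm (\<lambda>t. convolution f (dilate (2 ^ n) pulse) t - f t) * norm x"
        using norm_act_le[OF L1_diff[OF L1_convolution[OF f L] f]]
        by (intro always_eventually allI) (simp add: act_diff L1_convolution f L)
      have "filterlim (\<lambda>n::nat. 2 ^ n :: real) at_top sequentially"
        by (rule filterlim_at_top_mono[OF filterlim_real_sequentially])
           (simp add: less_imp_le of_nat_less_two_power)
      from approximate_identity[OF f pulse_L1 fourier_pulse_0 this]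
      show "(\<lambda>n. L1_norm (\<lambda>t. convolution f (dilate (2 ^ n) pulse) t - f t) * norm x) \<longlonglongrightarrow> 0"
        by (rule tendsto_mult_left_zero)
    qed
    then have "(\<lambda>n. act f (u n) - act f x) \<longlonglongrightarrow> 0"
      by (simp add: act_convolution f L u_def)
    moreover have "(\<lambda>n. act f (u n) - act f x) \<longlonglongrightarrow> act f z - act f x"
      by (intro tendsto_diff tendsto_const bounded_linear.tendsto[OF bounded_linear_act[OF f]] z)
    ultimately have "act f z - act f x = 0" by (rule LIMSEQ_unique[rotated])
    then show ?thesis by (simp add: act_diff_right[OF f])
  qed
  then have "z - x = 0" using nondeg unfolding nondegenerate_def by blast
  then show ?thesis using z by (simp add: u_def[abs_def])
qed

text \<open>It suffices to treat vectors of the form \<open>act f x\<close> with a pulse \<open>f\<close>, which are dense by the preceding lemma and on which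
the convolution algebra does the work.\<close>

theorem act_approximate_identity:
  assumes k: "k \<in> L1" "fourier k 0 = 1" and a: "filterlim a at_top sequentially"
  shows "(\<lambda>n. act (dilate (a n) k) x) \<longlonglongrightarrow> x"
proof (rule LIMSEQ_I)
  fix e :: real assume e: "e > 0"
  \<comment> \<open>\<open>C\<close> bounds the operator of every dilate of \<open>k\<close> minus the identity\<close>
  define C where "C = L1_norm k + 1"
  have C: "C > 0" by (simp add: C_def add_nonneg_pos)
  have "\<forall>\<^sub>F j in sequentially. dist (act (dilate (2 ^ j) pulse) x) x < e / (2 * C)"
    using e C by (intro tendstoD act_pulse_tendsto) simp
  then obtain j where j: "dist (act (dilate (2 ^ j) pulse) x) x < e / (2 * C)"
    by (auto simp: eventually_sequentially)
  define f where "f = dilate (2 ^ j) pulse"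
  have f: "f \<in> L1" unfolding f_def by (intro L1_dilate pulse_L1) simp
  have "(\<lambda>n. L1_norm (\<lambda>t. convolution f (dilate (a n) k) t - f t) * norm x) \<longlonglongrightarrow> 0"
    by (rule tendsto_mult_left_zero[OF approximate_identity[OF f k a]])
  then have 1: "\<forall>\<^sub>F n in sequentially. L1_norm (\<lambda>t. convolution f (dilate (a n) k) t - f t) * norm x < e / 2"
    by (rule order_tendstoD(2)) (use e in simp)
  have 2: "\<forall>\<^sub>F n in sequentially. a n > 0" using a by (simp add: filterlim_at_top_dense)
  have "\<forall>\<^sub>F n in sequentially. norm (act (dilate (a n) k) x - x) < e"
    using 1 2
  proof eventually_elim
    case (elim n)
    have kn: "dilate (a n) k \<in> L1" using elim k by (intro L1_dilate) auto
    let ?A = "act (dilate (a n) k)" and ?y = "act f x"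
    have lin: "?A (x - ?y) = ?A x - ?A ?y" by (rule act_diff_right[OF kn])
    have "norm (?A (x - ?y)) \<le> L1_norm k * norm (x - ?y)"
      using norm_act_le[OF kn, of "x - ?y"] L1_norm_dilate[of "a n" k] elim by simp
    moreover have "norm (?A ?y - ?y) \<le> L1_norm (\<lambda>t. convolution f (dilate (a n) k) t - f t) * norm x"
      using norm_act_le[OF L1_diff[OF L1_convolution[OF f kn] f], of x] act_commute[OF f kn, of x]
      by (simp add: act_diff L1_convolution f kn act_convolution)
    moreover have "norm (?A x - x) \<le> norm (?A x - ?A ?y) + norm (?A ?y - ?y) + norm (?y - x)"
      using norm_triangle_ineq[of "?A x - ?A ?y" "(?A ?y - ?y) + (?y - x)"]
        norm_triangle_ineq[of "?A ?y - ?y" "?y - x"] by simp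
    ultimately have "norm (?A x - x) \<le> C * norm (?y - x) + L1_norm (\<lambda>t. convolution f (dilate (a n) k) t - f t) * norm x"
      unfolding lin C_def by (simp add: norm_minus_commute[of x] algebra_simps)
    also have "C * norm (?y - x) < e / 2"
      using j C by (simp add: f_def dist_norm field_simps)
    finally show ?case using elim by simp
  qed
  then show "\<exists>no. \<forall>n\<ge>no. norm (act (dilate (a n) k) x - x) < e"
    by (simp add: eventually_sequentially)
qed

section \<open>Multipliers\<close>

text \<open>The action in terms of Fourier transforms, so that convolution becomes pointwise multiplication.\<close>

definition multiplier :: "(real \<Rightarrow> complex) \<Rightarrow> 'x \<Rightarrow> 'x" where
  "multiplier m = act (inv_fourier m)"

lemma multiplier_eq_act:
  assumes "f \<in> L1" "\<And>x. fourier f x = m x" shows "multiplier m y = act f y"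
proof -
  have m: "m \<in> FL1" using assms by (rule FL1_eqI)
  show ?thesis unfolding multiplier_def
    by (rule act_cong_fourier) (use m assms in \<open>simp_all add: inv_fourier\<close>)
qed

lemma multiplier_add:
  assumes "m \<in> FL1" "n \<in> FL1" shows "multiplier (\<lambda>x. m x + n x) y = multiplier m y + multiplier n y"
  unfolding multiplier_def[of m] multiplier_def[of n]
  using assms by (subst multiplier_eq_act[of "\<lambda>t. inv_fourier m t + inv_fourier n t"])
    (simp_all add: L1_add inv_fourier fourier_add act_add)

lemma multiplier_diff:
  assumes "m \<in> FL1" "n \<in> FL1" shows "multiplier (\<lambda>x. m x - n x) y = multiplier m y - multiplier n y"
  unfolding multiplier_def[of m] multiplier_def[of n]
  using assms by (subst multiplier_eq_act[of "\<lambda>t. inv_fourier m t - inv_fourier n t"])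
    (simp_all add: L1_diff inv_fourier fourier_diff act_diff)

lemma multiplier_cmult:
  assumes "m \<in> FL1" shows "multiplier (\<lambda>x. c * m x) y = c *\<^sub>C multiplier m y"
  unfolding multiplier_def[of m]
  using assms by (subst multiplier_eq_act[of "\<lambda>t. c * inv_fourier m t"])
    (simp_all add: L1_cmult inv_fourier fourier_cmult act_cmult)

lemma multiplier_times:
  assumes "m \<in> FL1" "n \<in> FL1" shows "multiplier (\<lambda>x. m x * n x) y = multiplier m (multiplier n y)"
  unfolding multiplier_def[of m] multiplier_def[of n]
  using assms by (subst multiplier_eq_act[of "convolution (inv_fourier m) (inv_fourier n)"])
    (simp_all add: L1_convolution inv_fourier fourier_convolution act_convolution)

lemma multiplier_0: "multiplier (\<lambda>x. 0) y = 0"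
proof -
  have "(\<lambda>x::real. 0::complex) \<in> FL1" using FL1_cmult[OF FL1_I[OF fejer_L1], of 0] by simp
  from multiplier_diff[OF this this, of y] show ?thesis by simp
qed

lemma bounded_linear_multiplier: "m \<in> FL1 \<Longrightarrow> bounded_linear (multiplier m)"
  unfolding multiplier_def by (intro bounded_linear_act inv_fourier_L1)

lemma multiplier_scaleC: "m \<in> FL1 \<Longrightarrow> multiplier m (c *\<^sub>C y) = c *\<^sub>C multiplier m y"
  unfolding multiplier_def by (intro act_scaleC_right inv_fourier_L1)

lemma norm_multiplier_le: "m \<in> FL1 \<Longrightarrow> norm (multiplier m y) \<le> L1_norm (inv_fourier m) * norm y"
  unfolding multiplier_def by (intro norm_act_le inv_fourier_L1)

lemma multiplier_diff_right: "m \<in> FL1 \<Longrightarrow> multiplier m (y - z) = multiplier m y - multiplier m z"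
  unfolding multiplier_def by (intro act_diff_right inv_fourier_L1)

lemma multiplier_zero_right: "m \<in> FL1 \<Longrightarrow> multiplier m 0 = 0"
  using multiplier_diff_right[of m 0 0] by simp

lemmas tendsto_multiplier = bounded_linear.tendsto[OF bounded_linear_multiplier]

lemma multiplier_commute: "m \<in> FL1 \<Longrightarrow> n \<in> FL1 \<Longrightarrow> multiplier m (multiplier n y) = multiplier n (multiplier m y)"
  unfolding multiplier_def by (intro act_commute inv_fourier_L1)

section \<open>Localisation at the Beurling spectrum\<close>

text \<open>On the frequencies in a small interval around \<open>c\<close>, the multiplier \<open>m\<close> is close to the scalar \<open>m c\<close> in operator norm. Mere
continuity of \<open>m\<close> would give this only pointwise; the bound comes from the central estimate with the de la Vallee Poussin kernel
dilated by a small \<open>d\<close> and modulated to \<open>c\<close>.\<close>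

lemma multiplier_local_approx:
  assumes m: "m \<in> FL1" and e: "e > 0"
  shows "\<exists>d>0. \<forall>y. norm (multiplier (\<lambda>x. (m x - m c) * of_real (tau 1 ((x - c) / d))) y) \<le> e * norm y"
proof -
  let ?g = "inv_fourier m" and ?V = vallee_poussin
  have g: "?g \<in> L1" "fourier ?g = m" using m by (simp_all add: inv_fourier)
  have inv: "(\<lambda>n. inverse (real (Suc n))) \<longlonglongrightarrow> 0" by (rule LIMSEQ_inverse_real_of_nat)
  have "\<forall>\<^sub>F n in sequentially. (LINT s|lborel. shift_modulus ?V (inverse (real (Suc n)) * s) * cmod (?g s)) < e"
    by (rule order_tendstoD(2)[OF shift_modulus_integral_tendsto[OF vallee_poussin_L1 g(1) inv] e])
  then obtain n where n: "(LINT s|lborel. shift_modulus ?V (inverse (real (Suc n)) * s) * cmod (?g s)) < e"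
    by (auto simp: eventually_sequentially)
  define d where "d = inverse (real (Suc n))"
  have d: "d > 0" by (simp add: d_def)
  define F where "F t = exp (\<i> * of_real t * of_real c) * dilate d ?V t" for t
  define k where "k t = convolution F ?g t - m c * F t" for t
  have V: "dilate d ?V \<in> L1" by (intro L1_dilate vallee_poussin_L1 d)
  have F: "F \<in> L1" unfolding F_def by (intro L1_modulate V)
  have fF: "fourier F x = of_real (tau 1 ((x - c) / d))" for x
    unfolding F_def fourier_modulated_dilate[OF d] by (simp add: fourier_vallee_poussin)
  have k: "k \<in> L1" unfolding k_def by (intro L1_diff L1_cmult L1_convolution F g)
  have fk: "fourier k x = (m x - m c) * of_real (tau 1 ((x - c) / d))" for x
  proof -
    have "fourier k x = fourier (convolution F ?g) x - fourier (\<lambda>t. m c * F t) x"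
      unfolding k_def by (rule fourier_diff[OF L1_convolution[OF F g(1)] L1_cmult[OF F]])
    also have "\<dots> = of_real (tau 1 ((x - c) / d)) * m x - m c * of_real (tau 1 ((x - c) / d))"
      by (simp add: fourier_convolution[OF F g(1)] fourier_cmult fF g(2))
    finally show ?thesis by (simp add: algebra_simps)
  qed
  have "L1_norm k \<le> (LINT s|lborel. shift_modulus (dilate d ?V) s * cmod (?g s))"
    using convolution_modulated_estimate[OF V g(1), of c] unfolding k_def F_def[abs_def] g(2) .
  also have "\<dots> < e" using n by (simp only: shift_modulus_dilate[OF d]) (simp add: d_def)
  finally have "L1_norm k \<le> e" by simp
  then have "norm (multiplier (\<lambda>x. (m x - m c) * of_real (tau 1 ((x - c) / d))) y) \<le> e * norm y" for y
    unfolding multiplier_eq_act[OF k fk]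
    by (intro order_trans[OF norm_act_le[OF k]] mult_right_mono) auto
  then show ?thesis using d by blast
qed

lemma beurling_spectrum_iff:
  "c \<in> beurling_spectrum act N \<longleftrightarrow> (\<forall>m\<in>FL1. (\<forall>y\<in>N. multiplier m y = 0) \<longrightarrow> m c = 0)"
proof
  assume "c \<in> beurling_spectrum act N"
  then have *: "\<And>f. f \<in> L1 \<Longrightarrow> (\<forall>y\<in>N. act f y = 0) \<Longrightarrow> fourier f c = 0"
    by (auto simp: beurling_spectrum_def)
  show "\<forall>m\<in>FL1. (\<forall>y\<in>N. multiplier m y = 0) \<longrightarrow> m c = 0"
  proof (intro ballI impI)
    fix m assume m: "m \<in> FL1" "\<forall>y\<in>N. multiplier m y = 0"
    show "m c = 0" using *[OF inv_fourier_L1[OF m(1)]] m by (simp add: multiplier_def fourier_inv_fourier)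
  qed
next
  assume *: "\<forall>m\<in>FL1. (\<forall>y\<in>N. multiplier m y = 0) \<longrightarrow> m c = 0"
  show "c \<in> beurling_spectrum act N"
    unfolding beurling_spectrum_def
  proof (intro CollectI ballI impI)
    fix f assume f: "f \<in> L1" "\<forall>y\<in>N. act f y = 0"
    have "multiplier (fourier f) y = act f y" for y by (rule multiplier_eq_act[OF f(1)]) simp
    then show "fourier f c = 0" using * FL1_I[OF f(1)] f(2) by auto
  qed
qed

lemma beurling_spectrum_mono: "N \<subseteq> N' \<Longrightarrow> beurling_spectrum act N \<subseteq> beurling_spectrum act N'"
  by (auto simp: beurling_spectrum_def)

lemma closed_beurling_spectrum: "closed (beurling_spectrum act N)"
proof -
  have "beurling_spectrum act N = (\<Inter>m\<in>{m\<in>FL1. \<forall>y\<in>N. multiplier m y = 0}. {x. m x = 0})"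
    by (auto simp: beurling_spectrum_iff)
  moreover have "closed {x. m x = 0}" if "m \<in> FL1" for m
    using FL1_continuous[OF that] by (intro closed_Collect_eq continuous_on_const) auto
  ultimately show ?thesis by auto
qed

text \<open>Wiener's local inversion, done on vectors. Take \<open>G\<close> with \<open>G(\<T>) y = 0\<close> and \<open>G c \<noteq> 0\<close>, and let \<open>z = m(\<T>) y\<close> with \<open>m\<close>
supported near \<open>c\<close>. There \<open>G\<close> and \<open>G c\<close> differ by an operator of norm at most \<open>\<bar>G c\<bar> / 2\<close>, while \<open>G(\<T>) z = 0\<close>;
hence \<open>\<bar>G c\<bar> \<parallel>z\<parallel> \<le> \<bar>G c\<bar> \<parallel>z\<parallel> / 2\<close> and \<open>z = 0\<close>.\<close>

lemma multiplier_vanish_near_point: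
  assumes "c \<notin> beurling_spectrum act {y}"
  shows "\<exists>d>0. \<forall>m\<in>FL1. (\<forall>x. d \<le> \<bar>x - c\<bar> \<longrightarrow> m x = 0) \<longrightarrow> multiplier m y = 0"
proof -
  obtain G where G: "G \<in> FL1" "multiplier G y = 0" "G c \<noteq> 0"
    using assms by (auto simp: beurling_spectrum_iff)
  then obtain d where d: "d > 0"
    and le: "\<And>z. norm (multiplier (\<lambda>x. (G x - G c) * of_real (tau 1 ((x - c) / d))) z) \<le> (cmod (G c) / 2) * norm z"
    using multiplier_local_approx[OF G(1), of "cmod (G c) / 2" c] by auto
  let ?V = "\<lambda>x. complex_of_real (tau 1 ((x - c) / d))"
  let ?r = "\<lambda>x. (G x - G c) * ?V x"
  have V: "?V \<in> FL1" using d by (rule FL1_tau1)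
  have r: "?r \<in> FL1"
    using FL1_diff[OF FL1_times[OF G(1) V] FL1_cmult[OF V, of "G c"]] by (simp add: left_diff_distrib)
  have "multiplier m y = 0" if m: "m \<in> FL1" "\<forall>x. d \<le> \<bar>x - c\<bar> \<longrightarrow> m x = 0" for m
  proof -
    let ?z = "multiplier m y"
    have "(\<lambda>x. G c * m x) = (\<lambda>x. m x * G x - ?r x * m x)"
    proof
      fix x
      show "G c * m x = m x * G x - ?r x * m x"
      proof (cases "\<bar>x - c\<bar> < d")
        case True
        then have "tau 1 ((x - c) / d) = 1" using d by (intro tau1_eq_1) (simp add: abs_divide)
        then show ?thesis by (simp add: algebra_simps)
      qed (use m(2) in simp)
    qed
    then have "G c *\<^sub>C ?z = multiplier (\<lambda>x. m x * G x - ?r x * m x) y"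
      using multiplier_cmult[OF m(1), of "G c" y] by simp
    also have "\<dots> = multiplier m (multiplier G y) - multiplier ?r ?z"
      by (simp only: multiplier_diff[OF FL1_times[OF m(1) G(1)] FL1_times[OF r m(1)]]
        multiplier_times[OF m(1) G(1)] multiplier_times[OF r m(1)])
    also have "\<dots> = - multiplier ?r ?z" by (simp add: G(2) multiplier_zero_right m(1))
    finally have eq: "G c *\<^sub>C ?z = - multiplier ?r ?z" .
    have "cmod (G c) * norm ?z = norm (G c *\<^sub>C ?z)" by (simp only: norm_scaleC)
    also have "\<dots> = norm (multiplier ?r ?z)" unfolding eq by (rule norm_minus_cancel)
    also have "\<dots> \<le> (cmod (G c) / 2) * norm ?z" by (rule le)
    finally have "cmod (G c) * norm ?z \<le> 0" by simp
    then show ?thesis using G(3) by (simp add: mult_le_0_iff)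
  qed
  then show ?thesis using d by blast
qed

lemma sum_tent:
  fixes N :: nat
  assumes "\<bar>x\<bar> \<le> real N"
  shows "(\<Sum>j<2 * N + 1. tent (x - (real j - real N))) = 1"
proof -
  let ?D = "\<lambda>u. (\<bar>u + 1\<bar> - \<bar>u\<bar>) / 2"
  have tent: "tent u = ?D u - ?D (u - 1)" for u
    by (simp add: tent_eq field_simps)
  have "(\<Sum>j<2 * N + 1. tent (x - (real j - real N))) =
      (\<Sum>j<2 * N + 1. ?D (x + real N - real j) - ?D (x + real N - real (Suc j)))"
    by (intro sum.cong refl, subst tent) (simp add: algebra_simps)
  also have "\<dots> = ?D (x + real N - real 0) - ?D (x + real N - real (2 * N + 1))"
    by (rule sum_lessThan_telescope')
  also have "\<dots> = 1"
  proof -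
    have "0 \<le> x + real N" "x \<le> real N" using assms by linarith+
    then show ?thesis by (simp add: abs_if)
  qed
  finally show ?thesis .
qed

text \<open>The support of \<open>m\<close> is covered by \<open>U\<close>, where \<open>m\<close> vanishes, and by the intervals of the preceding lemma. A Lebesgue number \<open>e\<close>
of the cover is chosen as the half-width of a partition of unity into tents; every piece of \<open>m\<close> then lies in one member of the cover
and annihilates \<open>y\<close>.\<close>

lemma multiplier_vanish_band_limited:
  assumes m: "m \<in> FL1" "band_limited m"
    and U: "open U" "beurling_spectrum act {y} \<subseteq> U" "\<And>x. x \<in> U \<Longrightarrow> m x = 0"
  shows "multiplier m y = 0"
proof -
  obtain R where R: "\<And>x. R \<le> \<bar>x\<bar> \<Longrightarrow> m x = 0" using m(2) by (auto simp: band_limited_def)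
  \<comment> \<open>the open sets in which, apart from \<open>U\<close>, no multiplier sees \<open>y\<close>\<close>
  define \<G> where "\<G> = {G. open G \<and> (\<forall>k\<in>FL1. (\<forall>x. x \<in> U \<or> x \<notin> G \<longrightarrow> k x = 0) \<longrightarrow> multiplier k y = 0)}"
  have "c \<in> \<Union>\<G>" for c
  proof (cases "c \<in> U")
    case True
    have "multiplier k y = 0" if "\<forall>x. k x = 0" for k
    proof -
      have "k = (\<lambda>x. 0)" using that by auto
      then show ?thesis by (simp add: multiplier_0)
    qed
    then have "U \<in> \<G>" using U(1) by (auto simp: \<G>_def)
    then show ?thesis using True by auto
  next
    case False
    then have "c \<notin> beurling_spectrum act {y}" using U(2) by auto
    from multiplier_vanish_near_point[OF this] obtain d where
      d: "d > 0" "\<And>k. k \<in> FL1 \<Longrightarrow> (\<forall>x. d \<le> \<bar>x - c\<bar> \<longrightarrow> k x = 0) \<Longrightarrow> multiplier k y = 0"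
      by blast
    have "multiplier k y = 0" if "k \<in> FL1" "\<forall>x. x \<in> U \<or> x \<notin> ball c d \<longrightarrow> k x = 0" for k
      using that by (intro d(2)) (auto simp: dist_real_def abs_minus_commute)
    then have "ball c d \<in> \<G>" by (auto simp: \<G>_def)
    then show ?thesis using d(1) by (auto intro: centre_in_ball[THEN iffD2])
  qed
  then have cov: "cball 0 (\<bar>R\<bar> + 1) \<subseteq> \<Union>\<G>" by auto
  obtain e0 where e0: "e0 > 0" "\<And>c. c \<in> cball 0 (\<bar>R\<bar> + 1) \<Longrightarrow> \<exists>G\<in>\<G>. ball c e0 \<subseteq> G"
    using Heine_Borel_lemma[OF compact_cball cov] by (auto simp: \<G>_def)
  define e where "e = min e0 1"
  have e: "e > 0" "e \<le> e0" "e \<le> 1" using e0 by (auto simp: e_def)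
  \<comment> \<open>\<open>2 N + 1\<close> tents centred at the multiples of \<open>e\<close> in \<open>[- N e, N e]\<close>; by \<open>e \<le> 1\<close> all centres stay in the covered ball\<close>
  define N where "N = nat \<lceil>\<bar>R\<bar> / e\<rceil>"
  have N1: "\<bar>R\<bar> \<le> real N * e"
  proof -
    have "\<bar>R\<bar> / e \<le> real N" unfolding N_def by (rule real_nat_ceiling_ge)
    then show ?thesis using e by (simp add: divide_le_eq)
  qed
  have N2: "real N * e \<le> \<bar>R\<bar> + 1"
  proof -
    have "0 \<le> \<bar>R\<bar> / e" using e by simp
    then have "0 \<le> \<lceil>\<bar>R\<bar> / e\<rceil>" using ceiling_mono[of 0 "\<bar>R\<bar> / e"] by simp
    then have "real N = of_int \<lceil>\<bar>R\<bar> / e\<rceil>" unfolding N_def by simp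
    then have "real N \<le> \<bar>R\<bar> / e + 1" using ceiling_correct[of "\<bar>R\<bar> / e"] by linarith
    then have "real N * e \<le> (\<bar>R\<bar> / e + 1) * e" using e by (intro mult_right_mono) auto
    also have "\<dots> \<le> \<bar>R\<bar> + 1" using e by (simp add: field_simps)
    finally show ?thesis .
  qed
  define c where "c j = (real j - real N) * e" for j :: nat
  let ?t = "\<lambda>j x. complex_of_real (tent ((x - c j) / e))"
  have piece: "multiplier (\<lambda>x. m x * ?t j x) y = 0" if j: "j < 2 * N + 1" for j
  proof -
    have "\<bar>c j\<bar> = \<bar>real j - real N\<bar> * e" using e by (simp add: c_def abs_mult)
    also have "\<dots> \<le> real N * e" using e j by (intro mult_right_mono) auto
    finally have "c j \<in> cball 0 (\<bar>R\<bar> + 1)" using N2 by simp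
    then obtain G where G: "G \<in> \<G>" "ball (c j) e0 \<subseteq> G" using e0(2) by blast
    have "m x * ?t j x = 0" if "x \<in> U \<or> x \<notin> G" for x
    proof (cases "x \<in> U")
      case False
      then have "x \<notin> ball (c j) e0" using that G(2) by auto
      then have "1 \<le> \<bar>(x - c j) / e\<bar>"
        using e by (auto simp: dist_real_def abs_divide abs_minus_commute)
      then show ?thesis by (simp add: tent_eq_0)
    qed (simp add: U(3))
    then show ?thesis using G(1) FL1_times[OF m(1) FL1_tent[OF e(1), of "c j"]] by (auto simp: \<G>_def)
  qed
  have psum: "multiplier (\<lambda>x. m x * (\<Sum>j<n. ?t j x)) y = 0 \<and> (\<lambda>x. m x * (\<Sum>j<n. ?t j x)) \<in> FL1"
    if "n \<le> 2 * N + 1" for n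
    using that
  proof (induction n)
    case 0
    show ?case using FL1_cmult[OF m(1), of 0] by (simp add: multiplier_0)
  next
    case (Suc n)
    then have IH: "multiplier (\<lambda>x. m x * (\<Sum>j<n. ?t j x)) y = 0" "(\<lambda>x. m x * (\<Sum>j<n. ?t j x)) \<in> FL1"
      by auto
    have p: "(\<lambda>x. m x * ?t n x) \<in> FL1" by (intro FL1_times m(1) FL1_tent e(1))
    have eq: "(\<lambda>x. m x * (\<Sum>j<Suc n. ?t j x)) = (\<lambda>x. m x * (\<Sum>j<n. ?t j x) + m x * ?t n x)"
      by (simp add: distrib_left)
    show ?case unfolding eq
      using FL1_add[OF IH(2) p] multiplier_add[OF IH(2) p, of y] IH(1) piece[of n] Suc.prems by simp
  qed
  have "m x * (\<Sum>j<2 * N + 1. ?t j x) = m x" for x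
  proof (cases "\<bar>x\<bar> \<le> real N * e")
    case True
    have "(\<Sum>j<2 * N + 1. tent ((x - c j) / e)) = (\<Sum>j<2 * N + 1. tent (x / e - (real j - real N)))"
      using e by (intro sum.cong refl arg_cong[of _ _ tent]) (simp add: c_def field_simps)
    also have "\<dots> = 1" using True e by (intro sum_tent) (simp add: abs_divide divide_le_eq)
    finally show ?thesis by (simp flip: of_real_sum)
  next
    case False
    then have "R \<le> \<bar>x\<bar>" using N1 by linarith
    then show ?thesis by (simp add: R)
  qed
  then have "(\<lambda>x. m x * (\<Sum>j<2 * N + 1. ?t j x)) = m" by auto
  then show ?thesis using psum[of "2 * N + 1"] by simp
qed

text \<open>With \<open>Suc n\<close> in the denominator the dilation is positive for all \<open>n\<close>; the support is \<open>[- n - 1, n + 1]\<close>.\<close>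

definition cutoff :: "nat \<Rightarrow> real \<Rightarrow> complex" where
  "cutoff n x = of_real (tent (x / real (Suc n)))"

lemma FL1_cutoff: "cutoff n \<in> FL1"
  using FL1_tent[of "real (Suc n)" 0] by (simp add: cutoff_def[abs_def])

lemma band_limited_cutoff: "band_limited (cutoff n)"
  using band_limited_tent[of "real (Suc n)" 0] by (simp add: cutoff_def[abs_def])

lemma multiplier_cutoff_tendsto: "(\<lambda>n. multiplier (cutoff n) y) \<longlonglongrightarrow> y"
proof -
  have "multiplier (cutoff n) y = act (dilate (real (Suc n)) fejer) y" for n
  proof (rule multiplier_eq_act)
    show "dilate (real (Suc n)) fejer \<in> L1" by (intro L1_dilate fejer_L1) simp
    show "fourier (dilate (real (Suc n)) fejer) x = cutoff n x" for x
      unfolding dilate_def by (subst fourier_dilate) (simp_all add: fourier_fejer cutoff_def)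
  qed
  moreover have "filterlim (\<lambda>n. real (Suc n)) at_top sequentially"
    by (rule filterlim_compose[OF filterlim_real_sequentially filterlim_Suc])
  then have "(\<lambda>n. act (dilate (real (Suc n)) fejer) y) \<longlonglongrightarrow> y"
    by (intro act_approximate_identity fejer_L1) (simp_all add: fourier_fejer tent_def)
  ultimately show ?thesis by simp
qed

text \<open>The band-limited case applies to \<open>m\<close> times a cut-off, and the cut-offs converge strongly to the identity.\<close>

theorem multiplier_vanish:
  assumes m: "m \<in> FL1"
    and U: "open U" "beurling_spectrum act {y} \<subseteq> U" "\<And>x. x \<in> U \<Longrightarrow> m x = 0"
  shows "multiplier m y = 0"
proof -
  have "multiplier (cutoff n) (multiplier m y) = 0" for n
  proof -
    have "multiplier (\<lambda>x. cutoff n x * m x) y = 0"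
      by (rule multiplier_vanish_band_limited[OF FL1_times[OF FL1_cutoff m] _ U(1,2)])
         (simp_all add: band_limited_times band_limited_cutoff U(3))
    then show ?thesis by (simp add: multiplier_times FL1_cutoff m)
  qed
  then show ?thesis using multiplier_cutoff_tendsto[of "multiplier m y"] by (simp add: LIMSEQ_const_iff)
qed

corollary multiplier_cong:
  assumes "m \<in> FL1" "n \<in> FL1" "open U" "beurling_spectrum act {y} \<subseteq> U" "\<And>x. x \<in> U \<Longrightarrow> m x = n x"
  shows "multiplier m y = multiplier n y"
  using multiplier_vanish[OF FL1_diff[OF assms(1,2)] assms(3,4)] assms by (simp add: multiplier_diff)

text \<open>A tent function at a point outside the support of \<open>m\<close> annihilates the vector without vanishing at that point.\<close>

lemma beurling_spectrum_multiplier: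
  assumes m: "m \<in> FL1" shows "beurling_spectrum act {multiplier m y} \<subseteq> supp m"
proof
  fix c assume c: "c \<in> beurling_spectrum act {multiplier m y}"
  show "c \<in> supp m"
  proof (rule ccontr)
    assume "c \<notin> supp m"
    then obtain d where d: "d > 0" "ball c d \<subseteq> - supp m"
      using supp_closed[of m] open_contains_ball[of "- supp m"] by (auto simp: open_Compl)
    have t: "(\<lambda>x. complex_of_real (tent ((x - c) / d))) \<in> FL1" using d(1) by (rule FL1_tent)
    have "complex_of_real (tent ((x - c) / d)) * m x = 0" for x
    proof (cases "\<bar>x - c\<bar> < d")
      case True
      then have "x \<notin> supp m" using d(2) by (auto simp: dist_real_def abs_minus_commute subset_iff)
      then have "m x = 0" using closure_subset[of "{x. m x \<noteq> 0}"] by (auto simp: supp_def)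
      then show ?thesis by simp
    next
      case False
      then have "tent ((x - c) / d) = 0" using d(1) by (intro tent_eq_0) (simp add: abs_divide)
      then show ?thesis by simp
    qed
    then have "(\<lambda>x. complex_of_real (tent ((x - c) / d)) * m x) = (\<lambda>x. 0)" by (rule ext)
    then have "multiplier (\<lambda>x. complex_of_real (tent ((x - c) / d))) (multiplier m y) = 0"
      unfolding multiplier_times[OF t m, symmetric] by (simp only: multiplier_0)
    then have "complex_of_real (tent ((c - c) / d)) = 0"
      using c t unfolding beurling_spectrum_iff by blast
    then show False by (simp add: tent_def)
  qed
qed

lemma multiplier_in_X_comp:
  assumes "m \<in> FL1" "band_limited m" shows "multiplier m y \<in> X_comp act"
proof -
  have "compact (supp m \<inter> beurling_spectrum act {multiplier m y})"
    using assms closed_beurling_spectrum by (intro compact_Int_closed) (simp add: compact_supp_iff)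
  moreover have "supp m \<inter> beurling_spectrum act {multiplier m y} = beurling_spectrum act {multiplier m y}"
    using beurling_spectrum_multiplier[OF assms(1)] by auto
  ultimately show ?thesis by (simp add: X_comp_def)
qed

section \<open>The graph of the closed operator\<close>

lemma FL1_loc_times: "h \<in> FL1_loc \<Longrightarrow> m \<in> FL1 \<Longrightarrow> band_limited m \<Longrightarrow> (\<lambda>x. h x * m x) \<in> FL1"
  by (simp add: FL1_loc_iff)

text \<open>For \<open>(x, y)\<close> in the set that will turn out to be the graph, cutting off both components lands in the graph before
closure; the trapezoid equal to \<open>1\<close> up to \<open>n + 2\<close> is a legitimate \<open>\<phi>\<close> as it is \<open>1\<close> around the support \<open>[- n - 1, n + 1]\<close> of the
cut-off.\<close>

lemma T_check_comp_graphI: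
  assumes h: "h \<in> FL1_loc"
    and eq: "\<And>m. m \<in> FL1 \<Longrightarrow> band_limited m \<Longrightarrow> multiplier m y = multiplier (\<lambda>x. h x * m x) x"
  shows "(multiplier (cutoff n) x, multiplier (cutoff n) y) \<in> T_check_comp_graph act h"
proof -
  define W where "W s = complex_of_real (tau 1 ((s - 0) / (real n + 2)))" for s
  define \<phi> where "\<phi> = inv_fourier W"
  have W: "W \<in> FL1" "band_limited W"
    unfolding W_def by (intro FL1_tau1 band_limited_tau1; simp)+
  have \<phi>: "\<phi> \<in> L1" "fourier \<phi> = W" unfolding \<phi>_def using W by (simp_all add: inv_fourier)
  have c0: "cutoff n s = 0" if "real n + 1 \<le> \<bar>s\<bar>" for s
    using that by (simp add: cutoff_def) (intro tent_eq_0, simp add: abs_divide le_divide_eq)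
  have W1: "W s = 1" if "\<bar>s\<bar> < real n + 2" for s
    using that by (simp add: W_def) (intro tau1_eq_1, simp add: abs_divide divide_le_eq)
  have hW: "(\<lambda>s. h s * W s) \<in> FL1" by (rule FL1_loc_times[OF h W])
  have "(\<lambda>s. h s * W s * cutoff n s) = (\<lambda>s. h s * cutoff n s)"
  proof
    fix s
    show "h s * W s * cutoff n s = h s * cutoff n s"
      by (cases "\<bar>s\<bar> < real n + 2") (simp_all add: W1 c0)
  qed
  then have "multiplier (\<lambda>s. h s * W s) (multiplier (cutoff n) x) = multiplier (cutoff n) y"
    unfolding multiplier_times[OF hW FL1_cutoff, symmetric]
    using eq[OF FL1_cutoff band_limited_cutoff] by simp
  then have y: "multiplier (cutoff n) y = act (inv_fourier (\<lambda>s. h s * fourier \<phi> s)) (multiplier (cutoff n) x)"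
    by (simp add: multiplier_def \<phi>)
  have "supp (cutoff n) \<subseteq> cball 0 (real n + 1)"
    unfolding supp_def by (rule closure_minimal) (use c0 in \<open>force simp: dist_norm\<close>, simp)
  then have "beurling_spectrum act {multiplier (cutoff n) x} \<subseteq> ball 0 (real n + 2)"
    using beurling_spectrum_multiplier[OF FL1_cutoff, of n x] by fastforce
  then have U: "\<exists>U. open U \<and> beurling_spectrum act {multiplier (cutoff n) x} \<subseteq> U \<and> (\<forall>\<xi>\<in>U. fourier \<phi> \<xi> = 1)"
    using W1 by (intro exI[of _ "ball 0 (real n + 2)"]) (auto simp: \<phi>)
  have "compact (supp (fourier \<phi>))" unfolding \<phi> using W(2) by (simp add: compact_supp_iff)
  then show ?thesis
    unfolding T_check_comp_graph_def using y U \<phi>(1) multiplier_in_X_comp[OF FL1_cutoff band_limited_cutoff, of n x]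
    by blast
qed

text \<open>The right-hand side is closed and contains the values on vectors of compact spectrum, by locality. Conversely, each
of its elements is the limit of its cut-offs. In particular the closure is the graph of a function, so the operator is
closable, and all further arguments need only identities between multipliers.\<close>

theorem T_check_eq:
  assumes h: "h \<in> FL1_loc"
  shows "T_check act h =
    {(x, y). \<forall>m\<in>FL1. band_limited m \<longrightarrow> multiplier m y = multiplier (\<lambda>s. h s * m s) x}" (is "_ = ?G")
proof
  have "?G = (\<Inter>m\<in>{m\<in>FL1. band_limited m}. {p. multiplier m (snd p) = multiplier (\<lambda>s. h s * m s) (fst p)})"
    by auto
  moreover have "closed {p. multiplier m (snd p) = multiplier (\<lambda>s. h s * m s) (fst p)}"
    if "m \<in> FL1" "band_limited m" for m
    using that FL1_loc_times[OF h]
    by (intro closed_Collect_eq bounded_linear.continuous_on[OF bounded_linear_multiplier] continuous_intros) auto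
  ultimately have "closed ?G" by auto
  moreover have "T_check_comp_graph act h \<subseteq> ?G"
  proof (clarsimp simp: T_check_comp_graph_def)
    fix x \<phi> m U
    assume \<phi>: "\<phi> \<in> L1" "compact (supp (fourier \<phi>))" and m: "m \<in> FL1" "band_limited m"
      and U: "open U" "beurling_spectrum act {x} \<subseteq> U" "\<forall>\<xi>\<in>U. fourier \<phi> \<xi> = 1"
    have h\<phi>: "(\<lambda>s. h s * fourier \<phi> s) \<in> FL1"
      using \<phi> by (intro FL1_loc_times[OF h] FL1_I) (simp_all add: compact_supp_iff)
    have "multiplier m (multiplier (\<lambda>s. h s * fourier \<phi> s) x) = multiplier (\<lambda>s. h s * m s) x"
      unfolding multiplier_times[OF m(1) h\<phi>, symmetric]
      by (rule multiplier_cong[OF FL1_times[OF m(1) h\<phi>] FL1_loc_times[OF h m] U(1,2)]) (use U(3) in simp)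
    then show "multiplier m (act (inv_fourier (\<lambda>\<xi>. h \<xi> * fourier \<phi> \<xi>)) x) = multiplier (\<lambda>s. h s * m s) x"
      by (simp add: multiplier_def)
  qed
  ultimately show "T_check act h \<subseteq> ?G"
    unfolding T_check_def by (intro closure_minimal)
next
  show "?G \<subseteq> T_check act h"
  proof (clarify)
    fix x y assume "\<forall>m\<in>FL1. band_limited m \<longrightarrow> multiplier m y = multiplier (\<lambda>s. h s * m s) x"
    then have "(multiplier (cutoff n) x, multiplier (cutoff n) y) \<in> T_check_comp_graph act h" for n
      by (intro T_check_comp_graphI[OF h]) auto
    moreover have "(\<lambda>n. (multiplier (cutoff n) x, multiplier (cutoff n) y)) \<longlonglongrightarrow> (x, y)"
      by (intro tendsto_Pair multiplier_cutoff_tendsto)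
    ultimately show "(x, y) \<in> T_check act h"
      unfolding T_check_def closure_sequential
      by (intro exI[of _ "\<lambda>n. (multiplier (cutoff n) x, multiplier (cutoff n) y)"]) auto
  qed
qed

lemma eq_by_cutoff:
  assumes "\<And>n. multiplier (cutoff n) x = multiplier (cutoff n) y" shows "x = y"
  using multiplier_cutoff_tendsto[of x] multiplier_cutoff_tendsto[of y]
  unfolding assms by (rule LIMSEQ_unique)

lemma op_apply_T_check:
  assumes h: "h \<in> FL1_loc" and xy: "(x, y) \<in> T_check act h"
  shows "op_apply (T_check act h) x = y"
  unfolding op_apply_def
proof (rule the_equality)
  show "(x, y) \<in> T_check act h" by (rule xy)
next
  fix y' assume "(x, y') \<in> T_check act h"
  then have "multiplier (cutoff n) y' = multiplier (cutoff n) y" for n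
    using xy unfolding T_check_eq[OF h] by (auto simp: FL1_cutoff band_limited_cutoff)
  then show "y' = y" by (rule eq_by_cutoff)
qed

section \<open>The resolvent outside the closure of the range\<close>

lemma resolvent_eqI:
  assumes h: "h \<in> FL1_loc"
    and R: "bounded_clinear R"
    and right: "\<And>y. (R y, \<mu> *\<^sub>C R y - y) \<in> T_check act h"
    and left: "\<And>x y. (x, y) \<in> T_check act h \<Longrightarrow> R (\<mu> *\<^sub>C x - y) = x"
  shows "\<mu> \<in> resolvent_set (T_check act h)" and "resolvent (T_check act h) \<mu> = R"
proof -
  let ?G = "T_check act h"
  let ?F = "\<lambda>x. \<mu> *\<^sub>C x - op_apply ?G x"
  have RF: "R (?F x) = x" if "x \<in> Domain ?G" for x
    using that by (auto simp: op_apply_T_check[OF h] left)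
  have FR: "?F (R y) = y" for y
    by (simp add: op_apply_T_check[OF h right])
  have dom: "R y \<in> Domain ?G" for y using right by auto
  have inj: "inj_on ?F (Domain ?G)" by (rule inj_on_inverseI) (rule RF)
  have bij: "bij_betw ?F (Domain ?G) UNIV"
  proof -
    have "y \<in> ?F ` Domain ?G" for y
      by (rule image_eqI[where x="R y"]) (rule FR[symmetric], rule dom)
    then show ?thesis using inj by (auto simp: bij_betw_def)
  qed
  show eq: "resolvent ?G \<mu> = R"
    unfolding resolvent_def by (rule ext) (rule inv_into_f_eq[OF inj dom FR])
  show "\<mu> \<in> resolvent_set ?G"
    unfolding resolvent_set_def using bij R eq by simp
qed

text \<open>The resolvent \<open>R\<close> is the strong limit of \<open>g\<^sub>a(\<T>)\<close>. On a vector cut off at frequency \<open>k + 1\<close> these operators do not depend on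
\<open>a \<ge> k + 1\<close>, because there \<open>tau a = 1\<close> and \<open>g\<^sub>a = 1 / (\<mu> - h)\<close> near the spectrum; such vectors are dense and the family is
uniformly bounded, so it converges everywhere. Both inverse identities are checked after multiplication with a band-limited \<open>m\<close>,
where they already hold for large finite \<open>a\<close>.\<close>

theorem resolvent_from_admissible_family:
  assumes h: "h \<in> FL1_loc" and g: "admissible_family act h \<mu> g"
  shows "\<mu> \<in> resolvent_set (T_check act h)"
    and "onorm (resolvent (T_check act h) \<mu>) \<le> M_bound g"
proof -
  let ?G = "T_check act h"
  have gF: "g a \<in> FL1" if "a > 0" for a using g that by (auto simp: admissible_family_def)
  have "\<forall>a\<in>{0<..}. \<exists>U. open U \<and> beurling_spectrum act UNIV \<subseteq> U \<and>
             (\<forall>\<xi>\<in>U. h \<xi> \<noteq> \<mu> \<and> g a \<xi> = of_real (tau a \<xi>) / (\<mu> - h \<xi>))"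
    using g by (auto simp: admissible_family_def)
  then obtain U where U: "\<And>a. a > 0 \<Longrightarrow> open (U a)" "\<And>a. a > 0 \<Longrightarrow> beurling_spectrum act UNIV \<subseteq> U a"
      "\<And>a s. a > 0 \<Longrightarrow> s \<in> U a \<Longrightarrow> h s \<noteq> \<mu> \<and> g a s = of_real (tau a s) / (\<mu> - h s)"
    unfolding bchoice_iff by (metis greaterThan_iff)
  have spec: "beurling_spectrum act {y} \<subseteq> U a" if "a > 0" for y a
    using U(2)[OF that] beurling_spectrum_mono[of "{y}" UNIV] by auto
  have g1: "g a s * (\<mu> - h s) = 1" if "a > 0" "s \<in> U a" "\<bar>s\<bar> \<le> a" for a s
    using U(3)[OF that(1,2)] that(3) by (auto simp: tau_def)
  have le: "norm (multiplier (g a) y) \<le> M_bound g * norm y" if a: "a > 0" for a y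
  proof -
    have "L1_norm (inv_fourier (g a)) \<le> M_bound g"
      unfolding M_bound_def using g a by (intro cSUP_upper) (auto simp: admissible_family_def)
    then show ?thesis
      by (intro order_trans[OF norm_multiplier_le[OF gF[OF a]]] mult_right_mono) auto
  qed
  have M0: "0 \<le> M_bound g"
  proof -
    have "0 \<le> L1_norm (inv_fourier (g 1))" by simp
    also have "\<dots> \<le> M_bound g"
      unfolding M_bound_def using g by (intro cSUP_upper) (auto simp: admissible_family_def)
    finally show ?thesis .
  qed
  define u where "u y n = multiplier (g (real (Suc n))) y" for y n
  have stable: "multiplier (g a) (multiplier (cutoff k) y) = multiplier (g b) (multiplier (cutoff k) y)"
    if ab: "real k + 1 \<le> a" "real k + 1 \<le> b" for a b k y
  proof -
    have pos: "a > 0" "b > 0" using ab by linarith+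
    have "g a s * cutoff k s = g b s * cutoff k s" if "s \<in> U a \<inter> U b" for s
    proof (cases "\<bar>s\<bar> < real k + 1")
      case True
      then have "tau a s = 1" "tau b s = 1" using ab by (simp_all add: tau_def)
      then show ?thesis using U(3)[OF pos(1)] U(3)[OF pos(2)] that by simp
    next
      case False
      then have "cutoff k s = 0"
        by (simp add: cutoff_def) (intro tent_eq_0, simp add: abs_divide le_divide_eq)
      then show ?thesis by simp
    qed
    then have "multiplier (\<lambda>s. g a s * cutoff k s) y = multiplier (\<lambda>s. g b s * cutoff k s) y"
      using spec[of a y] spec[of b y] U(1) pos
      by (intro multiplier_cong[where U="U a \<inter> U b"] FL1_times gF FL1_cutoff) auto
    then show ?thesis by (simp add: multiplier_times gF FL1_cutoff pos)
  qed
  have "Cauchy (u y)" for y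
  proof (rule CauchyI)
    fix e :: real assume e: "e > 0"
    define C where "C = 2 * M_bound g + 1"
    have C: "C > 0" using M0 by (simp add: C_def)
    have "\<forall>\<^sub>F k in sequentially. dist (multiplier (cutoff k) y) y < e / C"
      using e C by (intro tendstoD multiplier_cutoff_tendsto) simp
    then obtain k where "dist (multiplier (cutoff k) y) y < e / C"
      by (auto simp: eventually_sequentially)
    then have k: "C * norm (y - multiplier (cutoff k) y) < e"
      using C by (simp add: dist_norm norm_minus_commute pos_less_divide_eq mult.commute)
    show "\<exists>N. \<forall>m\<ge>N. \<forall>n\<ge>N. norm (u y m - u y n) < e"
    proof (intro exI allI impI)
      fix m n assume mn: "k \<le> m" "k \<le> n"
      let ?z = "y - multiplier (cutoff k) y"
      have "u y m - u y n = u ?z m - u ?z n"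
        unfolding u_def using mn stable[of k "real (Suc m)" "real (Suc n)" y] gF
        by (simp add: multiplier_diff_right)
      also have "norm \<dots> \<le> M_bound g * norm ?z + M_bound g * norm ?z"
        unfolding u_def by (intro order_trans[OF norm_triangle_ineq4] add_mono le) simp_all
      also have "\<dots> \<le> C * norm ?z" by (simp add: C_def algebra_simps)
      finally show "norm (u y m - u y n) < e" using k by simp
    qed
  qed
  then have conv: "convergent (u y)" for y by (simp add: Cauchy_convergent_iff)
  define R where "R y = lim (u y)" for y
  have lim: "u y \<longlonglongrightarrow> R y" for y using conv unfolding R_def by (simp add: convergent_LIMSEQ_iff)
  have nR: "norm (R y) \<le> M_bound g * norm y" for y
    by (rule LIMSEQ_le_const2[OF tendsto_norm[OF lim]]) (auto simp: u_def intro!: le)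
  have Radd: "R (x + y) = R x + R y" for x y
  proof (rule LIMSEQ_unique[OF lim])
    have "u (x + y) = (\<lambda>n. u x n + u y n)"
      unfolding u_def using gF by (auto simp: linear_add bounded_linear.linear[OF bounded_linear_multiplier])
    then show "u (x + y) \<longlonglongrightarrow> R x + R y" using tendsto_add[OF lim lim] by simp
  qed
  have RC: "R (c *\<^sub>C y) = c *\<^sub>C R y" for c y
  proof (rule LIMSEQ_unique[OF lim])
    have "u (c *\<^sub>C y) = (\<lambda>n. c *\<^sub>C u y n)" unfolding u_def using gF by (auto simp: multiplier_scaleC)
    then show "u (c *\<^sub>C y) \<longlonglongrightarrow> c *\<^sub>C R y" using tendsto_scaleC[OF lim] by simp
  qed
  have "bounded_linear R"
  proof (rule bounded_linear_intro[where K="M_bound g"])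
    show "R (r *\<^sub>R y) = r *\<^sub>R R y" for r y using RC[of "of_real r" y] by (simp add: scaleC_of_real)
  qed (simp_all add: Radd nR mult.commute)
  then have R: "bounded_clinear R" by (simp add: bounded_clinear_def RC)
  have large: "\<forall>\<^sub>F n in sequentially. r \<le> real (Suc n)" for r
  proof -
    obtain N where N: "r \<le> real N" using real_arch_simple by blast
    show ?thesis using N by (intro eventually_sequentiallyI[of N]) linarith
  qed
  have right: "(R y, \<mu> *\<^sub>C R y - y) \<in> ?G" for y
    unfolding T_check_eq[OF h]
  proof (clarify)
    fix m assume m: "m \<in> FL1" "band_limited m"
    then obtain r where r: "\<And>s. r \<le> \<bar>s\<bar> \<Longrightarrow> m s = 0" by (auto simp: band_limited_def)
    have hm: "(\<lambda>s. h s * m s) \<in> FL1" by (rule FL1_loc_times[OF h m])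
    have eq: "multiplier m (\<mu> *\<^sub>C multiplier (g a) y - y) = multiplier (\<lambda>s. h s * m s) (multiplier (g a) y)"
      if a: "a > 0" "r \<le> a" for a
    proof -
      have mg: "(\<lambda>s. m s * (\<mu> * g a s)) \<in> FL1" by (intro FL1_times m FL1_cmult gF a)
      have "multiplier m (\<mu> *\<^sub>C multiplier (g a) y - y) = multiplier (\<lambda>s. m s * (\<mu> * g a s) - m s) y"
        by (simp add: multiplier_diff[OF mg m(1)] multiplier_times[OF m(1) FL1_cmult[OF gF[OF a(1)]]]
             multiplier_cmult[OF gF[OF a(1)]] multiplier_diff_right[OF m(1)])
      also have "\<dots> = multiplier (\<lambda>s. (h s * m s) * g a s) y"
      proof (rule multiplier_cong[OF FL1_diff[OF mg m(1)] FL1_times[OF hm gF[OF a(1)]] U(1)[OF a(1)] spec[OF a(1)]])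
        fix s assume s: "s \<in> U a"
        show "m s * (\<mu> * g a s) - m s = h s * m s * g a s"
        proof (cases "\<bar>s\<bar> \<le> a")
          case True
          have "m s * (\<mu> * g a s) - h s * m s * g a s = m s * (g a s * (\<mu> - h s))"
            by (simp add: algebra_simps)
          also have "\<dots> = m s" using g1[OF a(1) s True] by simp
          finally show ?thesis by (simp add: algebra_simps)
        next
          case False
          then have "m s = 0" using a(2) by (intro r) linarith
          then show ?thesis by simp
        qed
      qed
      also have "\<dots> = multiplier (\<lambda>s. h s * m s) (multiplier (g a) y)"
        by (rule multiplier_times[OF hm gF[OF a(1)]])
      finally show ?thesis .
    qed
    have "\<forall>\<^sub>F n in sequentially. multiplier m (\<mu> *\<^sub>C u y n - y) = multiplier (\<lambda>s. h s * m s) (u y n)"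
      using large[of r] unfolding u_def by eventually_elim (rule eq; simp)
    moreover have "(\<lambda>n. multiplier m (\<mu> *\<^sub>C u y n - y)) \<longlonglongrightarrow> multiplier m (\<mu> *\<^sub>C R y - y)"
      by (intro tendsto_multiplier[OF m(1)] tendsto_diff tendsto_const tendsto_scaleC lim)
    ultimately have "(\<lambda>n. multiplier (\<lambda>s. h s * m s) (u y n)) \<longlonglongrightarrow> multiplier m (\<mu> *\<^sub>C R y - y)"
      by (rule Lim_transform_eventually[rotated])
    moreover have "(\<lambda>n. multiplier (\<lambda>s. h s * m s) (u y n)) \<longlonglongrightarrow> multiplier (\<lambda>s. h s * m s) (R y)"
      by (intro tendsto_multiplier[OF hm] lim)
    ultimately show "multiplier m (\<mu> *\<^sub>C R y - y) = multiplier (\<lambda>s. h s * m s) (R y)"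
      by (rule LIMSEQ_unique)
  qed
  have left: "R (\<mu> *\<^sub>C x - y) = x" if xy: "(x, y) \<in> ?G" for x y
  proof (rule eq_by_cutoff)
    fix k
    let ?c = "cutoff k" and ?w = "\<mu> *\<^sub>C x - y"
    have hc: "(\<lambda>s. h s * ?c s) \<in> FL1" by (rule FL1_loc_times[OF h FL1_cutoff band_limited_cutoff])
    have y: "multiplier ?c y = multiplier (\<lambda>s. h s * ?c s) x"
      using xy unfolding T_check_eq[OF h] by (simp add: FL1_cutoff band_limited_cutoff)
    have eq: "multiplier ?c (multiplier (g a) ?w) = multiplier ?c x" if a: "a > 0" "real (Suc k) \<le> a" for a
    proof -
      have mu: "(\<lambda>s. \<mu> * ?c s) \<in> FL1" by (intro FL1_cmult FL1_cutoff)
      have d: "(\<lambda>s. \<mu> * ?c s - h s * ?c s) \<in> FL1" by (rule FL1_diff[OF mu hc])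
      have "multiplier ?c (multiplier (g a) ?w) = multiplier (g a) (multiplier ?c ?w)"
        by (rule multiplier_commute[OF FL1_cutoff gF[OF a(1)]])
      also have "multiplier ?c ?w = multiplier (\<lambda>s. \<mu> * ?c s - h s * ?c s) x"
        by (simp add: multiplier_diff[OF mu hc] multiplier_cmult[OF FL1_cutoff]
             multiplier_diff_right[OF FL1_cutoff] multiplier_scaleC[OF FL1_cutoff] y)
      also have "multiplier (g a) \<dots> = multiplier (\<lambda>s. g a s * (\<mu> * ?c s - h s * ?c s)) x"
        by (rule multiplier_times[OF gF[OF a(1)] d, symmetric])
      also have "\<dots> = multiplier ?c x"
      proof (rule multiplier_cong[OF FL1_times[OF gF[OF a(1)] d] FL1_cutoff U(1)[OF a(1)] spec[OF a(1)]])
        fix s assume s: "s \<in> U a"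
        show "g a s * (\<mu> * ?c s - h s * ?c s) = ?c s"
        proof (cases "\<bar>s\<bar> \<le> a")
          case True
          have "g a s * (\<mu> * ?c s - h s * ?c s) = (g a s * (\<mu> - h s)) * ?c s"
            by (simp add: algebra_simps)
          then show ?thesis using g1[OF a(1) s True] by simp
        next
          case False
          then have "?c s = 0" using a(2)
            by (simp add: cutoff_def) (intro tent_eq_0, simp add: abs_divide le_divide_eq)
          then show ?thesis by simp
        qed
      qed
      finally show ?thesis .
    qed
    have "\<forall>\<^sub>F n in sequentially. multiplier ?c (u ?w n) = multiplier ?c x"
      using large[of "real (Suc k)"] unfolding u_def by eventually_elim (rule eq; simp)
    then have "(\<lambda>n. multiplier ?c (u ?w n)) \<longlonglongrightarrow> multiplier ?c x"
      by (rule tendsto_eventually)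
    moreover have "(\<lambda>n. multiplier ?c (u ?w n)) \<longlonglongrightarrow> multiplier ?c (R ?w)"
      by (intro tendsto_multiplier[OF FL1_cutoff] lim)
    ultimately show "multiplier ?c (R ?w) = multiplier ?c x" by (rule LIMSEQ_unique[rotated])
  qed
  show "\<mu> \<in> resolvent_set ?G" by (rule resolvent_eqI(1)[OF h R right left])
  have "resolvent ?G \<mu> = R" by (rule resolvent_eqI(2)[OF h R right left])
  then show "onorm (resolvent ?G \<mu>) \<le> M_bound g"
    using onorm_bound[OF M0 nR] by simp
qed

section \<open>Approximate eigenvectors\<close>

text \<open>Take \<open>x = t(\<T>) z\<close> with a narrow tent \<open>t\<close> at \<open>c\<close>; it can be chosen nonzero since \<open>t c \<noteq> 0\<close> and \<open>c\<close> lies in the spectrum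
of the module. The operator maps \<open>x\<close> to \<open>(h t)(\<T>) z\<close>, and near \<open>c\<close> the symbol \<open>h\<close> acts almost like \<open>h c\<close>.\<close>

lemma approximate_eigenvector:
  assumes h: "h \<in> FL1_loc" and c: "c \<in> beurling_spectrum act UNIV" and e: "e > 0"
  shows "\<exists>x y. (x, y) \<in> T_check act h \<and> x \<noteq> 0 \<and> norm (y - h c *\<^sub>C x) \<le> e * norm x"
proof -
  \<comment> \<open>\<open>h\<close> itself need not be a Fourier transform; the trapezoid \<open>?W\<close> makes it one without changing it on \<open>[c - 1, c + 1]\<close>\<close>
  let ?W = "\<lambda>s. complex_of_real (tau 1 ((s - c) / 1))"
  define k where "k s = h s * ?W s" for s
  have k: "k \<in> FL1"
    unfolding k_def by (intro FL1_loc_times[OF h] FL1_tau1 band_limited_tau1) simp_all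
  have kc: "k c = h c" by (simp add: k_def tau1_eq_1)
  obtain d where d: "d > 0"
    and le: "\<And>z. norm (multiplier (\<lambda>s. (k s - k c) * of_real (tau 1 ((s - c) / d))) z) \<le> e * norm z"
    using multiplier_local_approx[OF k e, of c] by auto
  let ?V = "\<lambda>s. complex_of_real (tau 1 ((s - c) / d))"
  let ?r = "\<lambda>s. (k s - k c) * ?V s"
  have V: "?V \<in> FL1" using d by (rule FL1_tau1)
  have r: "?r \<in> FL1"
    using FL1_diff[OF FL1_times[OF k V] FL1_cmult[OF V, of "k c"]] by (simp add: left_diff_distrib)
  define d' where "d' = min d 1"
  have d': "d' > 0" "d' \<le> d" "d' \<le> 1" using d by (auto simp: d'_def)
  define t where "t s = complex_of_real (tent ((s - c) / d'))" for s
  have t: "t \<in> FL1" "band_limited t"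
    unfolding t_def using d' by (auto intro: FL1_tent band_limited_tent)
  have "t c \<noteq> 0" by (simp add: t_def tent_def)
  then obtain z where z: "multiplier t z \<noteq> 0"
    using c t(1) unfolding beurling_spectrum_iff by blast
  define x where "x = multiplier t z"
  define y where "y = multiplier (\<lambda>s. h s * t s) z"
  have ht: "(\<lambda>s. h s * t s) \<in> FL1" by (rule FL1_loc_times[OF h t])
  have "multiplier m y = multiplier (\<lambda>s. h s * m s) x" if m: "m \<in> FL1" "band_limited m" for m
    unfolding x_def y_def multiplier_times[OF m(1) ht, symmetric]
      multiplier_times[OF FL1_loc_times[OF h m] t(1), symmetric]
    by (simp add: mult_ac)
  then have "(x, y) \<in> T_check act h" by (simp add: T_check_eq[OF h])
  moreover have "x \<noteq> 0" using z by (simp add: x_def)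
  moreover have "norm (y - h c *\<^sub>C x) \<le> e * norm x"
  proof -
    have "(\<lambda>s. h s * t s - h c * t s) = (\<lambda>s. ?r s * t s)"
    proof
      fix s
      show "h s * t s - h c * t s = ?r s * t s"
      proof (cases "\<bar>s - c\<bar> < d'")
        case True
        then have "tau 1 ((s - c) / 1) = 1" "tau 1 ((s - c) / d) = 1"
          using d d' by (auto intro!: tau1_eq_1 simp: abs_divide)
        then show ?thesis unfolding kc by (simp add: k_def left_diff_distrib)
      next
        case False
        then have "t s = 0" using d' by (simp add: t_def) (intro tent_eq_0, simp add: abs_divide)
        then show ?thesis by simp
      qed
    qed
    then have "multiplier (\<lambda>s. h s * t s - h c * t s) z = multiplier ?r x"
      unfolding x_def using multiplier_times[OF r t(1)] by simp
    then have "y - h c *\<^sub>C x = multiplier ?r x"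
      by (simp add: x_def y_def multiplier_diff[OF ht FL1_cmult[OF t(1)]] multiplier_cmult[OF t(1)])
    then show ?thesis using le by simp
  qed
  ultimately show ?thesis by blast
qed

text \<open>A resolvent of norm at most \<open>K\<close> bounds \<open>\<mu> - h(\<T>)\<close> below by \<open>1 / K\<close>, so approximate eigenvectors for \<open>h c\<close> force
\<open>\<bar>\<mu> - h c\<bar> \<ge> 1 / K\<close> for every \<open>c\<close> in the spectrum, a bound that survives the closure.\<close>

theorem resolvent_set_disjoint_closure:
  assumes h: "h \<in> FL1_loc" and \<mu>: "\<mu> \<in> resolvent_set (T_check act h)"
  shows "\<mu> \<notin> closure (h ` beurling_spectrum act UNIV)"
proof -
  let ?G = "T_check act h"
  let ?F = "\<lambda>x. \<mu> *\<^sub>C x - op_apply ?G x"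
  have inj: "inj_on ?F (Domain ?G)" and bl: "bounded_linear (resolvent ?G \<mu>)"
    using \<mu> by (auto simp: resolvent_set_def bij_betw_def bounded_clinear_def)
  obtain K where K: "K > 0" "\<And>y. norm (resolvent ?G \<mu> y) \<le> norm y * K"
    using bounded_linear.pos_bounded[OF bl] by auto
  have below: "norm x \<le> norm (\<mu> *\<^sub>C x - y) * K" if "(x, y) \<in> ?G" for x y
  proof -
    have "x = resolvent ?G \<mu> (?F x)"
      unfolding resolvent_def using inj that by (intro inv_into_f_f[symmetric]) auto
    then show ?thesis using K(2)[of "?F x"] op_apply_T_check[OF h that] by simp
  qed
  have far: "1 \<le> cmod (\<mu> - h c) * K" if c: "c \<in> beurling_spectrum act UNIV" for c
  proof (rule field_le_epsilon)
    fix e :: real assume e: "e > 0"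
    obtain x y where xy: "(x, y) \<in> ?G" "x \<noteq> 0" "norm (y - h c *\<^sub>C x) \<le> e / K * norm x"
      using approximate_eigenvector[OF h c, of "e / K"] e K(1) by auto
    have eq: "\<mu> *\<^sub>C x - y = (\<mu> - h c) *\<^sub>C x - (y - h c *\<^sub>C x)"
      using scaleC_add_left[of "\<mu> - h c" "h c" x] by simp
    have "norm (\<mu> *\<^sub>C x - y) \<le> norm ((\<mu> - h c) *\<^sub>C x) + norm (y - h c *\<^sub>C x)"
      unfolding eq by (rule norm_triangle_ineq4)
    also have "\<dots> \<le> cmod (\<mu> - h c) * norm x + e / K * norm x"
      using xy(3) by (simp add: norm_scaleC)
    finally have "norm (\<mu> *\<^sub>C x - y) \<le> cmod (\<mu> - h c) * norm x + e / K * norm x" .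
    then have "norm x \<le> (cmod (\<mu> - h c) * norm x + e / K * norm x) * K"
      using below[OF xy(1)] K(1) by (meson mult_right_mono order_trans less_imp_le)
    also have "\<dots> = (cmod (\<mu> - h c) * K + e) * norm x" using K(1) by (simp add: field_simps)
    finally show "1 \<le> cmod (\<mu> - h c) * K + e" using xy(2) by simp
  qed
  show ?thesis
  proof
    assume "\<mu> \<in> closure (h ` beurling_spectrum act UNIV)"
    then obtain c where c: "c \<in> beurling_spectrum act UNIV" "dist (h c) \<mu> < 1 / K"
      using K(1) by (auto simp: closure_approachable dest: spec[of _ "1 / K"])
    then have "cmod (\<mu> - h c) * K < 1" using K(1)
      by (simp add: dist_norm norm_minus_commute pos_less_divide_eq)
    then show False using far[OF c(1)] by simp
  qed
qed

end

theorem theorem3p12: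
  fixes act :: "(real \<Rightarrow> complex) \<Rightarrow> 'x::complex_banach \<Rightarrow> 'x"
    and T :: "real \<Rightarrow> 'x \<Rightarrow> 'x"
    and h :: "real \<Rightarrow> complex"
  assumes "banach_L1_module act"
    and "nondegenerate act"
    and "isometric_representation T"
    and "strongly_continuous T"
    and "associated act T"
    and "h \<in> FL1_loc"
    and "spectrally_admissible act h"
  shows "spectrum (T_check act h) = closure (h ` beurling_spectrum act UNIV) \<and>
    (\<forall>\<mu> g. \<mu> \<notin> closure (h ` beurling_spectrum act UNIV) \<longrightarrow> admissible_family act h \<mu> g \<longrightarrow>
       onorm (resolvent (T_check act h) \<mu>) \<le> M_bound g)"
proof -
  interpret L1_module act T by unfold_locales (rule assms)+
  have "\<mu> \<in> resolvent_set (T_check act h) \<longleftrightarrow> \<mu> \<notin> closure (h ` beurling_spectrum act UNIV)" for \<mu>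
  proof
    assume "\<mu> \<notin> closure (h ` beurling_spectrum act UNIV)"
    then obtain g where "admissible_family act h \<mu> g"
      using assms(7) by (auto simp: spectrally_admissible_def)
    then show "\<mu> \<in> resolvent_set (T_check act h)"
      by (rule resolvent_from_admissible_family(1)[OF assms(6)])
  qed (rule resolvent_set_disjoint_closure[OF assms(6)])
  then have "spectrum (T_check act h) = closure (h ` beurling_spectrum act UNIV)"
    by (auto simp: spectrum_def)
  then show ?thesis
    using resolvent_from_admissible_family(2)[OF assms(6)] by blast
qed

end
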